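(* Partial Vertex Cover admits a strict time and size efficient PSAKS.
   Context: Partial Vertex Cover, parameterized by solution size $k$, is the parameterized maximization problem $PVC(G,k,S)=-\infty$ if $|S|>k$, and otherwise the number of edges of $G$ incident on $S$. A PSAKS (polynomial size approximate kernelization scheme) is a family, one for every $\alpha>1$, of $\alpha$-approximate kernels of polynomial size: polynomial-time reduction algorithm $(I,k)\mapsto(I',k')$ with $|I'|+k'$ polynomial in $k$, and polynomial-time solution lifting algorithm with $\alpha\cdot\frac{\Pi(I,k,s)}{OPT(I,k)}\ge\frac{\Pi(I',k',s')}{OPT(I',k')}$. It is strict if in addition $\frac{\Pi(I,k,s)}{OPT(I,k)}\ge\min\{\frac{\Pi(I',k',s')}{OPT(I',k')},\frac{1}{\alpha}\}$; size efficient if the output size is bounded by $f(\alpha)\cdot k^c$ with $c$ independent of $\alpha$; time efficient if the reduction and lifting algorithms run in time $f(\alpha)\cdot|I|^c$ with $c$ independent of $\alpha$. *)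

theory Defs
  imports
    "HOL-Library.Extended_Real"
    "HOL-Library.Discrete_Functions"
    "HOL-Computational_Algebra.Polynomial"
begin

section \<open>Random access programs with running times\<close>

text \<open>
  A structured random access machine. The store consists of named arrays of natural numbers
  (the variable \<open>x\<close> is the cell \<open>Get x (Const 0)\<close>), and a program is a fixed finite object.
  Time is counted with the uniform cost measure. Addition and truncated subtraction are the only
  arithmetic operations: without multiplication a number gains at most one bit per operation, so
  that uniform cost polynomial time is polynomial time on Turing machines.
\<close>

type_synonym store = "nat \<Rightarrow> nat \<Rightarrow> nat"

datatype expr =
    Const nat
  | Get nat expr
  | Plus expr expr
  | Minus expr expr

datatype com =
    Skip
  | Put nat expr expr
  | Seq com com
  | If expr com com
  | While expr com

fun val :: "expr \<Rightarrow> store \<Rightarrow> nat" where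
  "val (Const n) \<sigma> = n"
| "val (Get a e) \<sigma> = \<sigma> a (val e \<sigma>)"
| "val (Plus e1 e2) \<sigma> = val e1 \<sigma> + val e2 \<sigma>"
| "val (Minus e1 e2) \<sigma> = val e1 \<sigma> - val e2 \<sigma>"

fun cost :: "expr \<Rightarrow> nat" where
  "cost (Const n) = 1"
| "cost (Get a e) = 1 + cost e"
| "cost (Plus e1 e2) = 1 + cost e1 + cost e2"
| "cost (Minus e1 e2) = 1 + cost e1 + cost e2"

text \<open>
  \<open>exec c \<sigma> t \<tau>\<close>: started in \<open>\<sigma>\<close>, the program \<open>c\<close> halts in \<open>\<tau>\<close> after \<open>t\<close> steps.
  A test \<open>e\<close> succeeds iff its value is nonzero.
\<close>

inductive exec :: "com \<Rightarrow> store \<Rightarrow> nat \<Rightarrow> store \<Rightarrow> bool" where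
  Skip: "exec Skip \<sigma> 1 \<sigma>"
| Put: "exec (Put a e1 e2) \<sigma> (1 + cost e1 + cost e2)
          (\<sigma>(a := (\<sigma> a)(val e1 \<sigma> := val e2 \<sigma>)))"
| Seq: "exec c1 \<sigma> t1 \<rho> \<Longrightarrow> exec c2 \<rho> t2 \<tau> \<Longrightarrow> exec (Seq c1 c2) \<sigma> (t1 + t2) \<tau>"
| IfTrue: "val e \<sigma> \<noteq> 0 \<Longrightarrow> exec c1 \<sigma> t \<tau> \<Longrightarrow> exec (If e c1 c2) \<sigma> (1 + cost e + t) \<tau>"
| IfFalse: "val e \<sigma> = 0 \<Longrightarrow> exec c2 \<sigma> t \<tau> \<Longrightarrow> exec (If e c1 c2) \<sigma> (1 + cost e + t) \<tau>"
| WhileFalse: "val e \<sigma> = 0 \<Longrightarrow> exec (While e c) \<sigma> (1 + cost e) \<sigma>"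
| WhileTrue: "val e \<sigma> \<noteq> 0 \<Longrightarrow> exec c \<sigma> t1 \<rho> \<Longrightarrow> exec (While e c) \<rho> t2 \<tau> \<Longrightarrow>
    exec (While e c) \<sigma> (1 + cost e + t1 + t2) \<tau>"

inductive_cases exec_SkipE: "exec Skip \<sigma> t \<tau>"
inductive_cases exec_PutE: "exec (Put a e1 e2) \<sigma> t \<tau>"
inductive_cases exec_SeqE: "exec (Seq c1 c2) \<sigma> t \<tau>"
inductive_cases exec_IfE: "exec (If e c1 c2) \<sigma> t \<tau>"
inductive_cases exec_WhileE: "exec (While e c) \<sigma> t \<tau>"

lemma exec_deterministic:
  "exec c \<sigma> t \<tau> \<Longrightarrow> exec c \<sigma> t' \<tau>' \<Longrightarrow> t' = t \<and> \<tau>' = \<tau>"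
proof (induction arbitrary: t' \<tau>' rule: exec.induct)
  case (Skip \<sigma>)
  then show ?case by (auto elim: exec_SkipE)
next
  case (Put a e1 e2 \<sigma>)
  then show ?case by (auto elim: exec_PutE)
next
  case (Seq c1 \<sigma> t1 \<rho> c2 t2 \<tau>)
  from Seq.prems obtain t1' \<rho>' t2' where
    "t' = t1' + t2'" "exec c1 \<sigma> t1' \<rho>'" "exec c2 \<rho>' t2' \<tau>'"
    by (rule exec_SeqE)
  with Seq.IH show ?case by metis
next
  case (IfTrue e \<sigma> c1 t \<tau> c2)
  from IfTrue.prems IfTrue.hyps obtain t1 where "t' = 1 + cost e + t1" "exec c1 \<sigma> t1 \<tau>'"
    by - (erule exec_IfE, simp_all)
  with IfTrue.IH show ?case by metis
next
  case (IfFalse e \<sigma> c2 t \<tau> c1)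
  from IfFalse.prems IfFalse.hyps obtain t2 where "t' = 1 + cost e + t2" "exec c2 \<sigma> t2 \<tau>'"
    by - (erule exec_IfE, simp_all)
  with IfFalse.IH show ?case by metis
next
  case (WhileFalse e \<sigma> c)
  from WhileFalse.prems show ?case by (rule exec_WhileE) (use WhileFalse.hyps in simp_all)
next
  case (WhileTrue e \<sigma> c t1 \<rho> t2 \<tau>)
  from WhileTrue.prems WhileTrue.hyps obtain t1' \<rho>' t2' where
    "t' = 1 + cost e + t1' + t2'" "exec c \<sigma> t1' \<rho>'" "exec (While e c) \<rho>' t2' \<tau>'"
    by - (erule exec_WhileE, simp_all)
  with WhileTrue.IH show ?case by metis
qed

section \<open>Parameterized maximization problems and approximate kernels\<close>

text \<open>The arguments are the instance, the parameter and the solution.\<close>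

type_synonym problem = "bool list \<Rightarrow> nat \<Rightarrow> bool list \<Rightarrow> ereal"

definition solutions :: "bool list \<Rightarrow> nat \<Rightarrow> bool list set" where
  "solutions I k = {s. length s \<le> length I + k}"

definition OPT :: "problem \<Rightarrow> bool list \<Rightarrow> nat \<Rightarrow> ereal" where
  "OPT \<Pi> I k = Max (\<Pi> I k ` solutions I k)"

text \<open>
  An optimal solution has ratio 1, also where the quotient would be \<open>0 / 0\<close>. Without this
  convention division in HOL would give \<open>0 / 0 = 0\<close>, and a reduction to an instance
  of optimum 0 would put no constraint on the lifted solution.
\<close>

definition ratio :: "problem \<Rightarrow> bool list \<Rightarrow> nat \<Rightarrow> bool list \<Rightarrow> ereal" where
  "ratio \<Pi> I k s = (if \<Pi> I k s = OPT \<Pi> I k then 1 else \<Pi> I k s / OPT \<Pi> I k)"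

text \<open>Inputs and outputs: a word is stored in an array, its length in front; a number is in cell 0.\<close>

definition word_array :: "bool list \<Rightarrow> nat \<Rightarrow> nat" where
  "word_array w = (\<lambda>i. if i = 0 then length w else if i \<le> length w then of_bool (w ! (i - 1)) else 0)"

definition num_array :: "nat \<Rightarrow> nat \<Rightarrow> nat" where
  "num_array k = (\<lambda>i. if i = 0 then k else 0)"

definition array_word :: "(nat \<Rightarrow> nat) \<Rightarrow> bool list" where
  "array_word m = map (\<lambda>i. m (Suc i) \<noteq> 0) [0..<m 0]"

lemma array_word_word_array: "array_word (word_array w) = w"
  by (rule nth_equalityI) (auto simp: array_word_def word_array_def)

definition zero_store :: store where
  "zero_store = (\<lambda>_ _. 0)"

text \<open>
  A preprocessing consists of a reduction program and a solution lifting program. The length of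
  the output word is charged to the running time, since a long word of zeros could otherwise be
  output by setting its length only.
\<close>

type_synonym preprocessing = "com \<times> com"

definition reduces ::
  "preprocessing \<Rightarrow> bool list \<Rightarrow> nat \<Rightarrow> nat \<Rightarrow> bool list \<Rightarrow> nat \<Rightarrow> bool" where
  "reduces P I k t I' k' \<longleftrightarrow>
    (\<exists>n \<tau>. exec (fst P) (zero_store(0 := word_array I, 1 := num_array k)) n \<tau> \<and>
      I' = array_word (\<tau> 0) \<and> k' = \<tau> 1 0 \<and> t = n + length I')"

definition lifts ::
  "preprocessing \<Rightarrow> bool list \<Rightarrow> nat \<Rightarrow> bool list \<Rightarrow> nat \<Rightarrow> bool list \<Rightarrow> nat \<Rightarrow> bool list \<Rightarrow> bool" where
  "lifts P I k I' k' s' t s \<longleftrightarrow>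
    (\<exists>n \<tau>. exec (snd P) (zero_store(0 := word_array I, 1 := num_array k, 2 := word_array I',
                                    3 := num_array k', 4 := word_array s')) n \<tau> \<and>
      s = array_word (\<tau> 0) \<and> t = n + length s)"

definition approx_preprocessing :: "real \<Rightarrow> problem \<Rightarrow> preprocessing \<Rightarrow> bool" where
  "approx_preprocessing \<alpha> \<Pi> P \<longleftrightarrow>
    (\<exists>p :: nat poly. \<forall>I k. \<exists>t I' k'. reduces P I k t I' k' \<and> t \<le> poly p (length I + k) \<and>
      (\<forall>s' \<in> solutions I' k'. \<exists>t' s. lifts P I k I' k' s' t' s \<and> t' \<le> poly p (length I + k) \<and>
        s \<in> solutions I k \<and> ereal \<alpha> * ratio \<Pi> I k s \<ge> ratio \<Pi> I' k' s'))"

definition poly_size :: "preprocessing \<Rightarrow> bool" where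
  "poly_size P \<longleftrightarrow>
    (\<exists>p :: nat poly. \<forall>I k t I' k'. reduces P I k t I' k' \<longrightarrow> length I' + k' \<le> poly p k)"

definition approx_poly_kernel :: "real \<Rightarrow> problem \<Rightarrow> preprocessing \<Rightarrow> bool" where
  "approx_poly_kernel \<alpha> \<Pi> P \<longleftrightarrow> approx_preprocessing \<alpha> \<Pi> P \<and> poly_size P"

definition strict_preprocessing :: "real \<Rightarrow> problem \<Rightarrow> preprocessing \<Rightarrow> bool" where
  "strict_preprocessing \<alpha> \<Pi> P \<longleftrightarrow>
    (\<forall>I k t I' k'. reduces P I k t I' k' \<longrightarrow>
      (\<forall>s' \<in> solutions I' k'. \<forall>t' s. lifts P I k I' k' s' t' s \<longrightarrow>
        ratio \<Pi> I k s \<ge> min (ratio \<Pi> I' k' s') (ereal (1 / \<alpha>))))"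

definition PSAKS :: "problem \<Rightarrow> (real \<Rightarrow> preprocessing) \<Rightarrow> bool" where
  "PSAKS \<Pi> A \<longleftrightarrow> (\<forall>\<alpha>>1. approx_poly_kernel \<alpha> \<Pi> (A \<alpha>))"

definition strict_PSAKS :: "problem \<Rightarrow> (real \<Rightarrow> preprocessing) \<Rightarrow> bool" where
  "strict_PSAKS \<Pi> A \<longleftrightarrow> PSAKS \<Pi> A \<and> (\<forall>\<alpha>>1. strict_preprocessing \<alpha> \<Pi> (A \<alpha>))"

definition size_efficient :: "(real \<Rightarrow> preprocessing) \<Rightarrow> bool" where
  "size_efficient A \<longleftrightarrow>
    (\<exists>(f :: real \<Rightarrow> real) (c :: nat). \<forall>\<alpha>>1. \<forall>I k t I' k'.
      reduces (A \<alpha>) I k t I' k' \<longrightarrow> real (length I' + k') \<le> f \<alpha> * real k ^ c)"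

text \<open>Since every run takes at least one step, the empty word is counted as having length 1.\<close>

definition time_efficient :: "(real \<Rightarrow> preprocessing) \<Rightarrow> bool" where
  "time_efficient A \<longleftrightarrow>
    (\<exists>(f :: real \<Rightarrow> real) (c :: nat). \<forall>\<alpha>>1. \<forall>I k t I' k'.
      reduces (A \<alpha>) I k t I' k' \<longrightarrow>
        real t \<le> f \<alpha> * real (max 1 (length I)) ^ c \<and>
        (\<forall>s' \<in> solutions I' k'. \<forall>t' s. lifts (A \<alpha>) I k I' k' s' t' s \<longrightarrow>
          real t' \<le> f \<alpha> * real (max 1 (length I)) ^ c))"

section \<open>Partial Vertex Cover\<close>

definition pvc_value :: "'v set set \<Rightarrow> nat \<Rightarrow> 'v set \<Rightarrow> ereal" where
  "pvc_value E k S = (if card S > k then -\<infinity> else ereal (real (card {e \<in> E. e \<inter> S \<noteq> {}})))"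

text \<open>
  A word is read as the adjacency matrix, row by row, of a simple graph on the vertices \<open>0, ..., n - 1\<close>
  where \<open>n\<close> is maximal such that the word has at least \<open>n\<^sup>2\<close> letters. The diagonal and the
  letters after the first \<open>n\<^sup>2\<close> are ignored, and an edge has to be marked in at least one of its two
  positions, so that every word is an instance. A solution is a characteristic vector of a vertex
  set, where missing letters count as \<open>False\<close> and surplus letters are ignored.
\<close>

definition word_order :: "bool list \<Rightarrow> nat" where
  "word_order I = floor_sqrt (length I)"

definition word_edges :: "bool list \<Rightarrow> nat set set" where
  "word_edges I = {{u, v} | u v.
    u < word_order I \<and> v < word_order I \<and> u \<noteq> v \<and> I ! (u * word_order I + v)}"

definition word_vertex_set :: "bool list \<Rightarrow> bool list \<Rightarrow> nat set" where
  "word_vertex_set I s = {v. v < word_order I \<and> v < length s \<and> s ! v}"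

definition PVC :: problem where
  "PVC I k s = pvc_value (word_edges I) k (word_vertex_set I s)"

lemma ex_word_for_graph:
  fixes E :: "nat set set"
  assumes "\<And>e. e \<in> E \<Longrightarrow> \<exists>u v. e = {u, v} \<and> u < n \<and> v < n \<and> u \<noteq> v"
  shows "\<exists>I. length I = n\<^sup>2 \<and> word_order I = n \<and> word_edges I = E"
proof -
  define I where "I = map (\<lambda>i. {i div n, i mod n} \<in> E) [0..<n\<^sup>2]"
  have len: "length I = n\<^sup>2" by (simp add: I_def)
  then have order: "word_order I = n" by (simp add: word_order_def)
  have nth: "I ! (u * n + v) \<longleftrightarrow> {u, v} \<in> E" if "u < n" "v < n" for u v
  proof -
    have "u * n + v < Suc u * n" using that by simp
    also have "\<dots> \<le> n * n" using that by (intro mult_le_mono1) simp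
    finally have "u * n + v < n\<^sup>2" by (simp add: power2_eq_square)
    then show ?thesis using that by (simp add: I_def)
  qed
  have iff: "e \<in> word_edges I \<longleftrightarrow>
      (\<exists>u v. e = {u, v} \<and> u < n \<and> v < n \<and> u \<noteq> v \<and> {u, v} \<in> E)" for e
    unfolding word_edges_def order mem_Collect_eq using nth by metis
  have "word_edges I = E"
  proof (rule set_eqI)
    fix e
    show "e \<in> word_edges I \<longleftrightarrow> e \<in> E"
      unfolding iff using assms[of e] by metis
  qed
  with len order show ?thesis by blast
qed

end

theory Submission
  imports Defs
begin

text \<open>
  Let \<open>b = min k n\<close>, fix \<open>c \<ge> \<alpha> / (\<alpha> - 1)\<close> and order the vertices by decreasing degree. Any \<open>k\<close> vertices
  cover at most the degree sum \<open>Z\<close> of the first \<open>b\<close> vertices, which themselves cover at least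
  \<open>Z - b\<^sup>2\<close> edges. If some degree exceeds \<open>c b\<^sup>2\<close>, a hub, then \<open>Z \<ge> c b\<^sup>2\<close> and these vertices are an
  \<open>\<alpha>\<close>-approximate solution, so the empty instance can be output. Otherwise an exchange argument
  yields an optimal solution among the first \<open>b (c b\<^sup>2 + 1)\<close> vertices: a solution vertex outside
  this core can be replaced by a core vertex which is neither in nor adjacent to the rest of the
  solution, and the degree does not drop. The subgraph induced by the core and its neighbours then
  has the same optimum, and its solutions are solutions of the input graph of at least the same value.
\<close>

section \<open>Running times of programs\<close>

text \<open>The requirement \<open>Z - b^2 \<ge> Z / \<alpha>\<close> is
  \<open>Z \<ge> \<alpha> / (\<alpha> - 1) * b^2\<close>, whence the bound on \<open>c\<close>. The
  core is allowed \<open>b (c b^2 + 1)\<close> vertices because the at most \<open>b - 1\<close>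
  other solution vertices, each with at most \<open>c b^2\<close> neighbours, block fewer than that.
  Strictness falls out of the case distinction: with a hub the lifted ratio is at least
  \<open>1 / \<alpha>\<close> whatever solution is handed back, and without a hub the ratio does not
  drop; these are the two arguments of the minimum. The machine shapes the rest. It cannot multiply,
  so products are computed as repeated sums, and the time has to be bounded by the word length alone
  although \<open>k\<close> may be far larger. Hence the sums run up to \<open>b\<close> instead of
  \<open>k\<close>. The number \<open>c\<close> enters the programs only as a literal of unit cost,
  so that the time bound is the same for all \<alpha>, and only the size depends on \<alpha>.
  Degrees, ranks and kept vertices are computed by one program which reduction and lifting
  share.\<close>

definition runs :: "com \<Rightarrow> store \<Rightarrow> nat \<Rightarrow> (store \<Rightarrow> bool) \<Rightarrow> bool" where
  "runs c \<sigma> T Q \<longleftrightarrow> (\<exists>t \<tau>. exec c \<sigma> t \<tau> \<and> t \<le> T \<and> Q \<tau>)"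

fun writes :: "com \<Rightarrow> nat set" where
  "writes Skip = {}"
| "writes (Put a e1 e2) = {a}"
| "writes (Seq c1 c2) = writes c1 \<union> writes c2"
| "writes (If e c1 c2) = writes c1 \<union> writes c2"
| "writes (While e c) = writes c"

definition agree_off :: "nat set \<Rightarrow> store \<Rightarrow> store \<Rightarrow> bool" where
  "agree_off A \<sigma> \<tau> \<longleftrightarrow> (\<forall>a. a \<notin> A \<longrightarrow> \<tau> a = \<sigma> a)"

lemma agree_offD: "agree_off A \<sigma> \<tau> \<Longrightarrow> a \<notin> A \<Longrightarrow> \<tau> a = \<sigma> a"
  by (simp add: agree_off_def)

text \<open>Serves as a frame rule. It is built into \<open>runs_conseq\<close> and
  \<open>runsE\<close>, so that postconditions only have to speak of the arrays that a program
  changes.\<close>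

lemma exec_writes: "exec c \<sigma> t \<tau> \<Longrightarrow> agree_off (writes c) \<sigma> \<tau>"
  by (induction rule: exec.induct) (auto simp: agree_off_def)

lemma runs_conseq:
  assumes "runs c \<sigma> T P" "T \<le> T'" "\<And>\<tau>. P \<tau> \<Longrightarrow> agree_off (writes c) \<sigma> \<tau> \<Longrightarrow> Q \<tau>"
  shows "runs c \<sigma> T' Q"
  using assms exec_writes unfolding runs_def by (meson le_trans)

lemma runsE:
  assumes "runs c \<sigma> T Q"
  obtains t \<tau> where "exec c \<sigma> t \<tau>" "t \<le> T" "Q \<tau>" "agree_off (writes c) \<sigma> \<tau>"
  using assms exec_writes unfolding runs_def by blast

lemma runs_Put:
  "Q (\<sigma>(a := (\<sigma> a)(val e1 \<sigma> := val e2 \<sigma>))) \<Longrightarrow> 1 + cost e1 + cost e2 \<le> T \<Longrightarrow>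
    runs (Put a e1 e2) \<sigma> T Q"
  unfolding runs_def using exec.Put by blast

text \<open>Address and value are separate premises, so that the expression to be stored can be
  evaluated by a lemma of its own instead of being unfolded by the simplifier.\<close>

lemma runs_store:
  assumes "val e1 \<sigma> = x" "val e2 \<sigma> = y" "Q (\<sigma>(a := (\<sigma> a)(x := y)))" "1 + cost e1 + cost e2 \<le> T"
  shows "runs (Put a e1 e2) \<sigma> T Q"
  using assms by (intro runs_Put) simp_all

lemma runs_Seq:
  "runs c1 \<sigma> T1 (\<lambda>\<rho>. runs c2 \<rho> T2 Q) \<Longrightarrow> runs (Seq c1 c2) \<sigma> (T1 + T2) Q"
  unfolding runs_def by (meson add_mono exec.Seq)

abbreviation cell :: "nat \<Rightarrow> expr" where
  "cell a \<equiv> Get a (Const 0)"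

definition For :: "nat \<Rightarrow> nat \<Rightarrow> com \<Rightarrow> com" where
  "For i b c = Seq (Put i (Const 0) (Const 0))
    (While (Minus (cell b) (cell i)) (Seq c (Put i (Const 0) (Plus (cell i) (Const 1)))))"

lemma writes_For [simp]: "writes (For i b c) = insert i (writes c)"
  by (auto simp: For_def)

text \<open>Besides its body a round costs 12: 6 for the test and 6 for the increment. The 9
  consists of 3 for the initialization and 6 for the last, failing test. Every round receives the
  frame relative to the initial store, so \<open>Inv\<close> need not repeat what the loop leaves
  alone.\<close>

lemma runs_For:
  assumes b: "\<sigma> b 0 = N" "i \<noteq> b" "b \<notin> writes c" "i \<notin> writes c"
    and init: "Inv 0 (\<sigma>(i := (\<sigma> i)(0 := 0)))"
    and step: "\<And>j \<rho>. j < N \<Longrightarrow> Inv j \<rho> \<Longrightarrow> \<rho> i 0 = j \<Longrightarrow> agree_off (insert i (writes c)) \<sigma> \<rho> \<Longrightarrow>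
      runs c \<rho> T (\<lambda>\<tau>. Inv (Suc j) (\<tau>(i := (\<tau> i)(0 := Suc j))))"
  shows "runs (For i b c) \<sigma> (N * (T + 12) + 9) (Inv N)"
proof -
  let ?w = "While (Minus (cell b) (cell i)) (Seq c (Put i (Const 0) (Plus (cell i) (Const 1))))"
  have loop: "runs ?w \<rho> ((N - j) * (T + 12) + 6) (Inv N)"
    if "j \<le> N" "Inv j \<rho>" "\<rho> i 0 = j" "agree_off (insert i (writes c)) \<sigma> \<rho>" for j \<rho>
    using that
  proof (induction "N - j" arbitrary: j \<rho>)
    case 0
    have "\<rho> b 0 = N"
      using 0 b by (simp add: agree_off_def)
    then have "exec ?w \<rho> (1 + cost (Minus (cell b) (cell i))) \<rho>"
      using 0 by (intro exec.WhileFalse) simp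
    then show ?case
      using 0 by (force simp: runs_def)
  next
    case (Suc d)
    have "\<rho> b 0 = N"
      using Suc b by (simp add: agree_off_def)
    then have test: "val (Minus (cell b) (cell i)) \<rho> \<noteq> 0"
      using Suc by simp
    obtain t \<tau> where \<tau>: "exec c \<rho> t \<tau>" "t \<le> T" "Inv (Suc j) (\<tau>(i := (\<tau> i)(0 := Suc j)))"
        "agree_off (writes c) \<rho> \<tau>"
      using step[of j \<rho>] Suc by (force elim: runsE)
    let ?\<tau> = "\<tau>(i := (\<tau> i)(0 := Suc j))"
    have "\<tau> i 0 = j"
      using \<tau>(4) b Suc by (simp add: agree_off_def)
    then have "exec (Put i (Const 0) (Plus (cell i) (Const 1))) \<tau> 6 ?\<tau>"
      using exec.Put[of i "Const 0" "Plus (cell i) (Const 1)" \<tau>] by (simp add: eval_nat_numeral)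
    with \<tau>(1) have body: "exec (Seq c (Put i (Const 0) (Plus (cell i) (Const 1)))) \<rho> (t + 6) ?\<tau>"
      by (rule exec.Seq)
    have "agree_off (insert i (writes c)) \<sigma> ?\<tau>"
      using Suc.prems(4) \<tau>(4) by (auto simp: agree_off_def)
    then have "runs ?w ?\<tau> ((N - Suc j) * (T + 12) + 6) (Inv N)"
      using Suc \<tau>(3) by (intro Suc.hyps(1)) auto
    then obtain t' \<tau>' where \<tau>': "exec ?w ?\<tau> t' \<tau>'" "t' \<le> (N - Suc j) * (T + 12) + 6" "Inv N \<tau>'"
      by (auto simp: runs_def)
    have "exec ?w \<rho> (1 + cost (Minus (cell b) (cell i)) + (t + 6) + t') \<tau>'"
      using exec.WhileTrue[OF test body \<tau>'(1)] .
    moreover have "N - j = Suc (N - Suc j)"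
      using Suc by simp
    then have "1 + cost (Minus (cell b) (cell i)) + (t + 6) + t' \<le> (N - j) * (T + 12) + 6"
      using \<tau>(2) \<tau>'(2) by simp
    ultimately show ?case
      using \<tau>'(3) unfolding runs_def by blast
  qed
  have "runs ?w (\<sigma>(i := (\<sigma> i)(0 := 0))) ((N - 0) * (T + 12) + 6) (Inv N)"
    using init by (intro loop) (auto simp: agree_off_def)
  then have "runs (For i b c) \<sigma> (3 + ((N - 0) * (T + 12) + 6)) (Inv N)"
    unfolding For_def by (intro runs_Seq runs_Put) simp_all
  then show ?thesis
    by (simp add: algebra_simps)
qed

section \<open>Loops for sums and for tables of sums\<close>

definition sum_loop :: "nat \<Rightarrow> nat \<Rightarrow> nat \<Rightarrow> expr \<Rightarrow> com" where
  "sum_loop a i b e = For i b (Put a (Const 0) (Plus (cell a) e))"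

lemma writes_sum_loop [simp]: "writes (sum_loop a i b e) = {i, a}"
  by (simp add: sum_loop_def)

text \<open>The slack \<open>X\<close> allows all stages of a program to be charged against the same
  quantity. The 26 is 17 per round, besides the cost of \<open>e\<close>, plus the 9 outside the
  rounds.\<close>

lemma runs_sum_loop:
  assumes "distinct [a, i, b]" "\<sigma> b 0 = N" "\<sigma> a 0 = s" "N + 1 \<le> X"
    and e: "\<And>\<rho> x. x < N \<Longrightarrow> \<rho> i 0 = x \<Longrightarrow> agree_off {i, a} \<sigma> \<rho> \<Longrightarrow> val e \<rho> = f x"
  shows "runs (sum_loop a i b e) \<sigma> ((cost e + 26) * X) (\<lambda>\<tau>. \<tau> a 0 = s + (\<Sum>x<N. f x))"
proof -
  have "runs (sum_loop a i b e) \<sigma> (N * (cost e + 5 + 12) + 9) (\<lambda>\<tau>. \<tau> a 0 = s + (\<Sum>x<N. f x))"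
    unfolding sum_loop_def using assms(1-3)
    by (intro runs_For[where Inv = "\<lambda>j \<rho>. \<rho> a 0 = s + (\<Sum>x<j. f x)"] runs_Put) (auto simp: e)
  moreover have "N * (cost e + 5 + 12) + 9 \<le> (cost e + 26) * (N + 1)"
    by (simp add: algebra_simps)
  then have "N * (cost e + 5 + 12) + 9 \<le> (cost e + 26) * X"
    using assms(4) by (meson le_trans mult_le_mono2)
  ultimately show ?thesis
    by (auto elim: runs_conseq)
qed

definition table_loop :: "nat \<Rightarrow> nat \<Rightarrow> nat \<Rightarrow> nat \<Rightarrow> expr \<Rightarrow> com" where
  "table_loop a i j b e = For i b (For j b (Put a (cell i) (Plus (Get a (cell i)) e)))"

lemma writes_table_loop [simp]: "writes (table_loop a i j b e) = {i, j, a}"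
  by (simp add: table_loop_def)

lemma runs_table_loop:
  assumes d: "distinct [a, i, j, b]" and b: "\<sigma> b 0 = N" and z: "\<And>x. \<sigma> a x = 0"
    and X: "(N + 1)\<^sup>2 \<le> X"
    and e: "\<And>\<rho> x y. x < N \<Longrightarrow> y < N \<Longrightarrow> \<rho> i 0 = x \<Longrightarrow> \<rho> j 0 = y \<Longrightarrow>
      agree_off {i, j, a} \<sigma> \<rho> \<Longrightarrow> val e \<rho> = f x y"
  shows "runs (table_loop a i j b e) \<sigma> ((cost e + 49) * X)
    (\<lambda>\<tau>. \<forall>x<N. \<tau> a x = (\<Sum>y<N. f x y))"
proof -
  \<comment> \<open>Rows are accumulated in place, so the invariant has to say that the rows not yet
    begun are still zero.\<close>
  define P where "P x \<rho> \<longleftrightarrow> (\<forall>x'. \<rho> a x' = (if x' < x then \<Sum>y<N. f x' y else 0))"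
    for x and \<rho> :: store
  have inner: "runs (For j b (Put a (cell i) (Plus (Get a (cell i)) e))) \<rho>
      (N * (cost e + 7 + 12) + 9) (\<lambda>\<tau>. P (Suc x) (\<tau>(i := (\<tau> i)(0 := Suc x))))"
    if x: "x < N" "P x \<rho>" "\<rho> i 0 = x" "agree_off {i, j, a} \<sigma> \<rho>" for x \<rho>
  proof -
    let ?Inv = "\<lambda>y \<tau>. \<forall>x'. \<tau> a x' =
      (if x' < x then \<Sum>y<N. f x' y else if x' = x then \<Sum>y'<y. f x y' else 0)"
    have "runs (For j b (Put a (cell i) (Plus (Get a (cell i)) e))) \<rho>
      (N * (cost e + 7 + 12) + 9) (?Inv N)"
    proof (rule runs_For[where Inv = ?Inv])
      show "\<rho> b 0 = N"
        using x(4) b d by (simp add: agree_off_def)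
      show "?Inv 0 (\<rho>(j := (\<rho> j)(0 := 0)))"
        using x(2) d by (simp add: P_def)
      fix y \<rho>'
      assume y: "y < N" "?Inv y \<rho>'" "\<rho>' j 0 = y"
        and "agree_off (insert j (writes (Put a (cell i) (Plus (Get a (cell i)) e)))) \<rho> \<rho>'"
      then have *: "agree_off {j, a} \<rho> \<rho>'"
        by simp
      then have i: "\<rho>' i 0 = x"
        using x(3) d by (simp add: agree_off_def)
      have "agree_off {i, j, a} \<sigma> \<rho>'"
        using * x(4) by (simp add: agree_off_def)
      then have "val e \<rho>' = f x y"
        using i y x(1) by (intro e)
      then show "runs (Put a (cell i) (Plus (Get a (cell i)) e)) \<rho>' (cost e + 7)
          (\<lambda>\<tau>. ?Inv (Suc y) (\<tau>(j := (\<tau> j)(0 := Suc y))))"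
        using y i d by (intro runs_Put) auto
    qed (use d in auto)
    then show ?thesis
      by (rule runs_conseq) (use d in \<open>auto simp: P_def less_Suc_eq\<close>)
  qed
  have "runs (table_loop a i j b e) \<sigma> (N * (N * (cost e + 7 + 12) + 9 + 12) + 9) (P N)"
    unfolding table_loop_def
    by (rule runs_For[where Inv = P]) (use b d z inner in \<open>auto simp: P_def\<close>)
  moreover have "N * (N * (cost e + 7 + 12) + 9 + 12) + 9 \<le> (cost e + 49) * (N + 1)\<^sup>2"
    by (simp add: power2_eq_square algebra_simps)
  then have "N * (N * (cost e + 7 + 12) + 9 + 12) + 9 \<le> (cost e + 49) * X"
    using X by (meson le_trans mult_le_mono2)
  ultimately show ?thesis
    by (auto simp: P_def elim!: runs_conseq)
qed

section \<open>The kernel\<close>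

text \<open>Symmetrized, because an edge may be marked in only one of its two positions.\<close>

definition adj :: "bool list \<Rightarrow> nat \<Rightarrow> nat \<Rightarrow> bool" where
  "adj I u v \<longleftrightarrow> u \<noteq> v \<and> (I ! (u * word_order I + v) \<or> I ! (v * word_order I + u))"

definition deg :: "bool list \<Rightarrow> nat \<Rightarrow> nat" where
  "deg I v = card {u. u < word_order I \<and> adj I v u}"

text \<open>Decreasing degree, ties broken by the index.\<close>

definition precedes :: "bool list \<Rightarrow> nat \<Rightarrow> nat \<Rightarrow> bool" where
  "precedes I u v \<longleftrightarrow> deg I v + of_bool (v \<le> u) \<le> deg I u"

definition rank :: "bool list \<Rightarrow> nat \<Rightarrow> nat" where
  "rank I v = card {u. u < word_order I \<and> precedes I u v}"

text \<open>No vertex set has more than \<open>word_order I\<close> elements, so the cap loses no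
  solution. It keeps the loops that sum up to the budget within the length of the word, however
  large \<open>k\<close> is.\<close>

definition budget :: "bool list \<Rightarrow> nat \<Rightarrow> nat" where
  "budget I k = min k (word_order I)"

definition threshold :: "nat \<Rightarrow> bool list \<Rightarrow> nat \<Rightarrow> nat" where
  "threshold c I k = budget I k * (budget I k * c)"

definition has_hub :: "nat \<Rightarrow> bool list \<Rightarrow> nat \<Rightarrow> bool" where
  "has_hub c I k \<longleftrightarrow> (\<exists>v<word_order I. threshold c I k < deg I v)"

text \<open>The core is empty if there is a hub, so that \<open>reduced\<close> is then the empty word.\<close>

definition core :: "nat \<Rightarrow> bool list \<Rightarrow> nat \<Rightarrow> nat set" where
  "core c I k = {v. v < word_order I \<and> \<not> has_hub c I k \<and>
    rank I v < budget I k * (threshold c I k + 1)}"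

definition kept :: "nat \<Rightarrow> bool list \<Rightarrow> nat \<Rightarrow> nat set" where
  "kept c I k = {v. v < word_order I \<and> (\<exists>u\<in>core c I k. u = v \<or> adj I u v)}"

text \<open>The increasing renumbering of \<open>W\<close> by an initial segment. Counting smaller
  elements is something a table loop can do.\<close>

definition position :: "nat set \<Rightarrow> nat \<Rightarrow> nat" where
  "position W v = card {u \<in> W. u < v}"

definition reduced :: "nat \<Rightarrow> bool list \<Rightarrow> nat \<Rightarrow> bool list" where
  "reduced c I k = (let W = kept c I k; N = card W; f = inv_into W (position W) in
    map (\<lambda>i. adj I (f (i div N)) (f (i mod N))) [0..<N * N])"

text \<open>One formula for both cases: without a hub the first disjunct is false, and with a hub
  the kept set is empty and the second is false. The test \<open>rank I v < k\<close> needs no cap,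
  as ranks lie below the order anyway.\<close>

definition lifted :: "nat \<Rightarrow> bool list \<Rightarrow> nat \<Rightarrow> bool list \<Rightarrow> bool list" where
  "lifted c I k s = map (\<lambda>v. has_hub c I k \<and> rank I v < k \<or>
    v \<in> kept c I k \<and> position (kept c I k) v < length s \<and> s ! position (kept c I k) v)
    [0..<word_order I]"

lemma position_less:
  assumes "finite W" "u \<in> W" "u < v"
  shows "position W u < position W v"
  unfolding position_def using assms by (intro psubset_card_mono) auto

lemma bij_betw_position:
  assumes "finite W"
  shows "bij_betw (position W) W {..<card W}"
proof -
  have inj: "inj_on (position W) W"
    by (rule linorder_inj_onI') (use position_less[OF assms] in force)
  have "position W v < card W" if "v \<in> W" for v
    unfolding position_def using assms that by (intro psubset_card_mono) auto
  then have "position W ` W = {..<card W}"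
    using inj by (intro card_subset_eq) (auto simp: card_image)
  with inj show ?thesis
    by (simp add: bij_betw_def)
qed

lemma kept_subset: "kept c I k \<subseteq> {..<word_order I}"
  by (auto simp: kept_def)

lemma finite_kept [simp]: "finite (kept c I k)"
  using finite_subset[OF kept_subset] by blast

lemma card_kept_le: "card (kept c I k) \<le> word_order I"
  using card_mono[OF _ kept_subset] by fastforce

lemma word_order_le: "word_order I \<le> length I"
  by (simp add: word_order_def floor_sqrt_le)

lemma word_order_square_le: "word_order I * word_order I \<le> length I"
  using floor_sqrt_power2_le[of "length I"] by (simp add: word_order_def power2_eq_square)

lemma matrix_index_less: "u < n \<Longrightarrow> v < n \<Longrightarrow> u * n + v < n * n" for n :: nat
  by (metis add.commute add_less_le_mono le_trans mult_Suc mult_le_mono1 nat_neq_iff not_less_eq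
      Suc_leI add_less_cancel_right less_le_trans)

lemma sum_of_bool_card: "(\<Sum>y<N. of_bool (P y)) = card {y. y < N \<and> P y}" for N :: nat
  by (simp add: Int_def)

section \<open>Programs for the kernel and the lifting\<close>

text \<open>Truncated subtraction maps every nonzero number to 1, so that truth values can be summed
  to counts.\<close>

definition truth :: "expr \<Rightarrow> expr" where
  "truth e = Minus (Const 1) (Minus (Const 1) e)"

definition both :: "expr \<Rightarrow> expr \<Rightarrow> expr" where
  "both e1 e2 = Minus (Plus (truth e1) (truth e2)) (Const 1)"

definition differ :: "expr \<Rightarrow> expr \<Rightarrow> expr" where
  "differ e1 e2 = Plus (Minus e1 e2) (Minus e2 e1)"

lemma val_truth [simp]: "val (truth e) \<sigma> = of_bool (val e \<sigma> \<noteq> 0)"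
  by (simp add: truth_def)

lemma val_both [simp]: "val (both e1 e2) \<sigma> = of_bool (val e1 \<sigma> \<noteq> 0 \<and> val e2 \<sigma> \<noteq> 0)"
  by (auto simp: both_def)

lemma val_differ [simp]: "val (differ e1 e2) \<sigma> = 0 \<longleftrightarrow> val e1 \<sigma> = val e2 \<sigma>"
  unfolding differ_def val.simps by arith

lemma cost_truth [simp]: "cost (truth e) = 4 + cost e"
  by (simp add: truth_def)

lemma cost_both [simp]: "cost (both e1 e2) = 11 + cost e1 + cost e2"
  by (simp add: both_def)

lemma cost_differ [simp]: "cost (differ e1 e2) = 3 + 2 * cost e1 + 2 * cost e2"
  by (simp add: differ_def)

text \<open>Arrays of the programs; 0 to 4 are taken by the input and the output.\<close>

abbreviation (input) "aOrd \<equiv> 5 :: nat"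
abbreviation (input) "aSq \<equiv> 6 :: nat"
abbreviation (input) "aI \<equiv> 7 :: nat"
abbreviation (input) "aJ \<equiv> 8 :: nat"
abbreviation (input) "aWord \<equiv> 9 :: nat"
abbreviation (input) "aRow \<equiv> 10 :: nat"
abbreviation (input) "aDeg \<equiv> 11 :: nat"
abbreviation (input) "aRank \<equiv> 12 :: nat"
abbreviation (input) "aBud \<equiv> 13 :: nat"
abbreviation (input) "aLin \<equiv> 14 :: nat"
abbreviation (input) "aThr \<equiv> 15 :: nat"
abbreviation (input) "aCore \<equiv> 16 :: nat"
abbreviation (input) "aHub \<equiv> 17 :: nat"
abbreviation (input) "aKept \<equiv> 18 :: nat"
abbreviation (input) "aPos \<equiv> 19 :: nat"
abbreviation (input) "aCard \<equiv> 20 :: nat"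
abbreviation (input) "aInv \<equiv> 21 :: nat"
abbreviation (input) "aOut \<equiv> 22 :: nat"

text \<open>The matrix index would need a product; the array \<open>aRow\<close> holds the row
  offsets instead, computed once by repeated addition.\<close>

definition adj_expr :: "expr \<Rightarrow> expr \<Rightarrow> expr" where
  "adj_expr x y = both (differ x y)
    (Plus (Get aWord (Plus (Get aRow x) y)) (Get aWord (Plus (Get aRow y) x)))"

lemma cost_adj_expr [simp]: "cost (adj_expr x y) = 21 + 4 * cost x + 4 * cost y"
  by (simp add: adj_expr_def)

lemma val_adj_expr:
  assumes "val x \<rho> < word_order I" "val y \<rho> < word_order I"
    and "\<And>v. v < word_order I \<Longrightarrow> \<rho> aRow v = v * word_order I"
    and "\<And>p. p < length I \<Longrightarrow> \<rho> aWord p = of_bool (I ! p)"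
  shows "val (adj_expr x y) \<rho> = of_bool (adj I (val x \<rho>) (val y \<rho>))"
proof -
  have "val x \<rho> * word_order I + val y \<rho> < length I" "val y \<rho> * word_order I + val x \<rho> < length I"
    using assms(1,2) matrix_index_less word_order_square_le less_le_trans by meson+
  then show ?thesis
    using assms by (simp add: adj_expr_def adj_def)
qed

text \<open>Square root by odd numbers: adding \<open>2 j + 1\<close> turns the square of
  \<open>j\<close> into the square of \<open>j + 1\<close>, and the order counts the squares that do
  not exceed the length of the word.\<close>

definition find_order :: com where
  "find_order = For aI 0
    (Seq (Put aSq (Const 0) (Plus (cell aSq) (Plus (cell aI) (Plus (cell aI) (Const 1)))))
      (Put aOrd (Const 0) (Plus (cell aOrd) (truth (Minus (Plus (cell 0) (Const 1)) (cell aSq))))))"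

lemma writes_find_order [simp]: "writes find_order = {aI, aSq, aOrd}"
  by (auto simp: find_order_def)

lemma runs_find_order:
  assumes "\<sigma> 0 0 = length I" "\<And>x. \<sigma> aOrd x = 0" "\<And>x. \<sigma> aSq x = 0" "length I + 1 \<le> X"
  shows "runs find_order \<sigma> (49 * X) (\<lambda>\<tau>. \<tau> aOrd 0 = word_order I)"
proof -
  let ?n = "floor_sqrt (length I)"
  have *: "(if Suc (j * j + (j + j)) \<le> length I then 1 else 0) + min j ?n = min (Suc j) ?n" for j
  proof -
    have "Suc (j * j + (j + j)) \<le> length I \<longleftrightarrow> Suc j \<le> ?n"
      by (simp add: le_floor_sqrt_iff power2_eq_square algebra_simps)
    then show ?thesis by auto
  qed
  have "runs find_order \<sigma> (length I * (12 + 16 + 12) + 9)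
      (\<lambda>\<tau>. \<tau> aSq 0 = length I * length I \<and> \<tau> aOrd 0 = min (length I) ?n)"
    unfolding find_order_def
  proof (rule runs_For[where Inv = "\<lambda>j \<tau>. \<tau> aSq 0 = j * j \<and> \<tau> aOrd 0 = min j ?n"])
    fix j \<rho>
    assume "\<rho> aSq 0 = j * j \<and> \<rho> aOrd 0 = min j ?n" "\<rho> aI 0 = j"
      and "agree_off (insert aI (writes
        (Seq (Put aSq (Const 0) (Plus (cell aSq) (Plus (cell aI) (Plus (cell aI) (Const 1)))))
        (Put aOrd (Const 0) (Plus (cell aOrd) (truth (Minus (Plus (cell 0) (Const 1)) (cell aSq)))))))) \<sigma> \<rho>"
    moreover from this(3) have "\<rho> 0 0 = length I"
      using assms(1) by (simp add: agree_off_def)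
    ultimately show "runs (Seq (Put aSq (Const 0) (Plus (cell aSq) (Plus (cell aI) (Plus (cell aI) (Const 1)))))
        (Put aOrd (Const 0) (Plus (cell aOrd) (truth (Minus (Plus (cell 0) (Const 1)) (cell aSq)))))) \<rho> (12 + 16)
        (\<lambda>\<tau>. (\<tau>(aI := (\<tau> aI)(0 := Suc j))) aSq 0 = Suc j * Suc j \<and>
          (\<tau>(aI := (\<tau> aI)(0 := Suc j))) aOrd 0 = min (Suc j) ?n)"
      using *[of j] by (intro runs_Seq runs_Put) (auto simp: not_less_eq_eq)
  qed (use assms in auto)
  then show ?thesis
    by (rule runs_conseq)
      (use assms(4) floor_sqrt_le[of "length I"] in \<open>auto simp: word_order_def\<close>)
qed

text \<open>The output goes to array 0, where the input stands. The copy leaves the matrix readable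
  while the new one is written, and its shift by one drops the length cell.\<close>

definition copy_word :: com where
  "copy_word = For aI 0 (Put aWord (cell aI) (Get 0 (Plus (cell aI) (Const 1))))"

lemma writes_copy_word [simp]: "writes copy_word = {aI, aWord}"
  by (simp add: copy_word_def)

lemma runs_copy_word:
  assumes "\<sigma> 0 = word_array I" "length I + 1 \<le> X"
  shows "runs copy_word \<sigma> (29 * X) (\<lambda>\<tau>. \<forall>p<length I. \<tau> aWord p = of_bool (I ! p))"
proof -
  have "runs copy_word \<sigma> (length I * (8 + 12) + 9) (\<lambda>\<tau>. \<forall>p<length I. \<tau> aWord p = of_bool (I ! p))"
    unfolding copy_word_def
  proof (rule runs_For[where Inv = "\<lambda>j \<tau>. \<forall>p<j. \<tau> aWord p = of_bool (I ! p)"])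
    fix j \<rho>
    assume *: "j < length I" "\<forall>p<j. \<rho> aWord p = of_bool (I ! p)" "\<rho> aI 0 = j"
      "agree_off (insert aI (writes (Put aWord (cell aI) (Get 0 (Plus (cell aI) (Const 1)))))) \<sigma> \<rho>"
    have "\<rho> 0 = word_array I"
      using *(4) assms(1) by (simp add: agree_off_def)
    then show "runs (Put aWord (cell aI) (Get 0 (Plus (cell aI) (Const 1)))) \<rho> 8
        (\<lambda>\<tau>. \<forall>p<Suc j. (\<tau>(aI := (\<tau> aI)(0 := Suc j))) aWord p = of_bool (I ! p))"
      using * by (intro runs_Put) (auto simp: word_array_def less_Suc_eq)
  qed (use assms in \<open>auto simp: word_array_def\<close>)
  then show ?thesis
    by (rule runs_conseq) (use assms(2) in auto)
qed


text \<open>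
  Products are sums over a constant. The value of \<open>1 - (i - j)\<close> in the third table is \<open>of_bool (i \<le> j)\<close>,
  so that this table counts the \<open>j\<close> which precede \<open>i\<close>.
\<close>

definition prepare :: "nat \<Rightarrow> com" where
  "prepare c =
    Seq find_order
    (Seq copy_word
    (Seq (table_loop aRow aI aJ aOrd (cell aI))
    (Seq (table_loop aDeg aI aJ aOrd (adj_expr (cell aI) (cell aJ)))
    (Seq (table_loop aRank aI aJ aOrd
      (truth (Minus (Plus (Get aDeg (cell aJ)) (Const 1))
        (Plus (Get aDeg (cell aI)) (Minus (Const 1) (Minus (cell aI) (cell aJ)))))))
    (Seq (Put aBud (Const 0) (Minus (cell aOrd) (Minus (cell aOrd) (cell 1))))
    (Seq (sum_loop aLin aI aBud (Const c))
    (Seq (sum_loop aThr aI aBud (cell aLin))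
    (Seq (sum_loop aCore aI aBud (Plus (cell aThr) (Const 1)))
    (Seq (sum_loop aHub aI aOrd (Minus (Get aDeg (cell aI)) (cell aThr)))
    (Seq (table_loop aKept aI aJ aOrd
      (both (both (Minus (Const 1) (cell aHub)) (Minus (cell aCore) (Get aRank (cell aJ))))
        (Plus (adj_expr (cell aJ) (cell aI)) (Minus (Const 1) (differ (cell aI) (cell aJ))))))
    (Seq (table_loop aPos aI aJ aOrd (both (Minus (cell aI) (cell aJ)) (Get aKept (cell aJ))))
      (sum_loop aCard aI aOrd (truth (Get aKept (cell aI)))))))))))))))"

lemma writes_prepare: "writes (prepare c) \<subseteq> {5..20}"
  by (auto simp: prepare_def)

text \<open>The interface of the shared program: only what reduction and lifting read afterwards,
  which is why degrees and threshold do not occur.\<close>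

definition prepared :: "nat \<Rightarrow> bool list \<Rightarrow> nat \<Rightarrow> store \<Rightarrow> bool" where
  "prepared c I k \<sigma> \<longleftrightarrow> \<sigma> aOrd 0 = word_order I \<and>
    (\<forall>v<word_order I. \<sigma> aRow v = v * word_order I) \<and>
    (\<forall>p<length I. \<sigma> aWord p = of_bool (I ! p)) \<and>
    (\<forall>v<word_order I. \<sigma> aRank v = rank I v) \<and>
    (\<sigma> aHub 0 \<noteq> 0 \<longleftrightarrow> has_hub c I k) \<and>
    (\<forall>v<word_order I. \<sigma> aKept v \<noteq> 0 \<longleftrightarrow> v \<in> kept c I k) \<and>
    (\<forall>v<word_order I. \<sigma> aPos v = position (kept c I k) v) \<and>
    \<sigma> aCard 0 = card (kept c I k)"

text \<open>Symbolic execution stage by stage. The growing fact lists \<open>f1\<close>,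
  \<open>f2\<close>, ... trace each array back to the stage that wrote it last. All stages are
  linear in \<open>X\<close>, and their constants sum to less than 1000.\<close>

lemma runs_prepare:
  assumes "\<sigma> 0 = word_array I" "\<sigma> 1 0 = k" and zero: "\<And>a x. 5 \<le> a \<Longrightarrow> \<sigma> a x = 0"
  shows "runs (prepare c) \<sigma> (1000 * (length I + 1)\<^sup>2) (prepared c I k)"
proof -
  define n where "n = word_order I"
  define X where "X = (length I + 1)\<^sup>2"
  have nX: "n + 1 \<le> X" "(n + 1)\<^sup>2 \<le> X" "length I + 1 \<le> X" "1 \<le> X"
    using word_order_le[of I] power_mono[of "n + 1" "length I + 1" 2]
    by (auto simp: n_def X_def power2_eq_square)
  have bX: "budget I k + 1 \<le> X"
    using nX(1) by (simp add: budget_def n_def)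

  obtain t1 s1 where e1: "exec find_order \<sigma> t1 s1" "t1 \<le> 49 * X" "s1 aOrd 0 = n"
      "agree_off {aI, aSq, aOrd} \<sigma> s1"
    using runs_find_order[of \<sigma> I X] assms nX unfolding n_def
    by (auto simp: word_array_def elim!: runsE)
  note f1 = agree_offD[OF e1(4)]

  obtain t2 s2 where e2: "exec copy_word s1 t2 s2" "t2 \<le> 29 * X"
      "\<forall>p<length I. s2 aWord p = of_bool (I ! p)" "agree_off {aI, aWord} s1 s2"
    using runs_copy_word[of s1 I X] assms nX by (auto simp: f1 elim!: runsE)
  note f2 = f1 agree_offD[OF e2(4)]

  let ?e3 = "cell aI"
  have v3: "val ?e3 \<rho> = x" if "\<rho> aI 0 = x" for \<rho> x
    using that by simp
  have "runs (table_loop aRow aI aJ aOrd ?e3) s2 ((cost ?e3 + 49) * X)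
      (\<lambda>\<tau>. \<forall>x<n. \<tau> aRow x = (\<Sum>y<n. x))"
    by (rule runs_table_loop[where f = "\<lambda>x y. x", OF _ _ _ _ v3])
      (use e1(3) zero nX in \<open>simp_all add: f2\<close>)
  then obtain t3 s3 where e3: "exec (table_loop aRow aI aJ aOrd ?e3) s2 t3 s3"
      "t3 \<le> (cost ?e3 + 49) * X" "\<forall>x<n. s3 aRow x = (\<Sum>y<n. x)"
      "agree_off (writes (table_loop aRow aI aJ aOrd ?e3)) s2 s3"
    by (rule runsE)
  note f3 = f2 agree_offD[OF e3(4)]
  have row: "s3 aRow x = x * n" if "x < n" for x
    using e3(3) that by simp

  have adj_val: "val (adj_expr x y) \<rho> = of_bool (adj I (val x \<rho>) (val y \<rho>))"
    if "val x \<rho> < n" "val y \<rho> < n" "\<rho> aRow = s3 aRow" "\<rho> aWord = s2 aWord" for x y \<rho>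
    using that e2(3) row by (intro val_adj_expr) (auto simp: n_def)

  let ?e4 = "adj_expr (cell aI) (cell aJ)"
  have v4: "val ?e4 \<rho> = of_bool (adj I x y)" if "x < n" "y < n" "\<rho> aI 0 = x" "\<rho> aJ 0 = y"
      "agree_off {aI, aJ, aDeg} s3 \<rho>" for \<rho> x y
    using that(1-4) by (simp add: adj_val agree_offD[OF that(5)] f3)
  have "runs (table_loop aDeg aI aJ aOrd ?e4) s3 ((cost ?e4 + 49) * X)
      (\<lambda>\<tau>. \<forall>x<n. \<tau> aDeg x = (\<Sum>y<n. of_bool (adj I x y)))"
    by (rule runs_table_loop[where f = "\<lambda>x y. of_bool (adj I x y)", OF _ _ _ _ v4])
      (use e1(3) zero nX in \<open>simp_all add: f3\<close>)
  then obtain t4 s4 where e4: "exec (table_loop aDeg aI aJ aOrd ?e4) s3 t4 s4"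
      "t4 \<le> (cost ?e4 + 49) * X" "\<forall>x<n. s4 aDeg x = (\<Sum>y<n. of_bool (adj I x y))"
      "agree_off (writes (table_loop aDeg aI aJ aOrd ?e4)) s3 s4"
    by (rule runsE)
  note f4 = f3 agree_offD[OF e4(4)]
  have degs: "s4 aDeg x = deg I x" if "x < n" for x
    using e4(3) that by (simp only: sum_of_bool_card deg_def n_def)

  let ?e5 = "truth (Minus (Plus (Get aDeg (cell aJ)) (Const 1))
        (Plus (Get aDeg (cell aI)) (Minus (Const 1) (Minus (cell aI) (cell aJ)))))"
  have v5: "val ?e5 \<rho> = of_bool (precedes I y x)" if "x < n" "y < n" "\<rho> aI 0 = x" "\<rho> aJ 0 = y"
      "agree_off {aI, aJ, aRank} s4 \<rho>" for \<rho> x y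
    using that(1-4) by (auto simp: agree_offD[OF that(5)] degs precedes_def)
  have "runs (table_loop aRank aI aJ aOrd ?e5) s4 ((cost ?e5 + 49) * X)
      (\<lambda>\<tau>. \<forall>x<n. \<tau> aRank x = (\<Sum>y<n. of_bool (precedes I y x)))"
    by (rule runs_table_loop[where f = "\<lambda>x y. of_bool (precedes I y x)", OF _ _ _ _ v5])
      (use e1(3) zero nX in \<open>simp_all add: f4\<close>)
  then obtain t5 s5 where e5: "exec (table_loop aRank aI aJ aOrd ?e5) s4 t5 s5"
      "t5 \<le> (cost ?e5 + 49) * X" "\<forall>x<n. s5 aRank x = (\<Sum>y<n. of_bool (precedes I y x))"
      "agree_off (writes (table_loop aRank aI aJ aOrd ?e5)) s4 s5"
    by (rule runsE)
  note f5 = f4 agree_offD[OF e5(4)]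
  have ranks: "s5 aRank x = rank I x" if "x < n" for x
    using e5(3) that by (simp only: sum_of_bool_card rank_def n_def)

  \<comment> \<open>By truncation, \<open>n - (n - k)\<close> is the minimum of \<open>k\<close> and
    \<open>n\<close>.\<close>
  let ?e6 = "Minus (cell aOrd) (Minus (cell aOrd) (cell 1))"
  have "runs (Put aBud (Const 0) ?e6) s5 (10 * X) (\<lambda>\<tau>. \<tau> aBud 0 = budget I k)"
    using e1(3) assms(2) nX by (intro runs_Put) (auto simp: f5 budget_def n_def)
  then obtain t6 s6 where e6: "exec (Put aBud (Const 0) ?e6) s5 t6 s6" "t6 \<le> 10 * X"
      "s6 aBud 0 = budget I k" "agree_off (writes (Put aBud (Const 0) ?e6)) s5 s6"
    by (rule runsE)
  note f6 = f5 agree_offD[OF e6(4)]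

  let ?e7 = "Const c"
  have v7: "val ?e7 \<rho> = c" for \<rho>
    by simp
  have "runs (sum_loop aLin aI aBud ?e7) s6 ((cost ?e7 + 26) * X)
      (\<lambda>\<tau>. \<tau> aLin 0 = 0 + (\<Sum>x<budget I k. c))"
    by (rule runs_sum_loop[where f = "\<lambda>x. c", OF _ _ _ _ v7])
      (use e6(3) zero nX bX in \<open>simp_all add: f6\<close>)
  then obtain t7 s7 where e7: "exec (sum_loop aLin aI aBud ?e7) s6 t7 s7"
      "t7 \<le> (cost ?e7 + 26) * X" "s7 aLin 0 = 0 + (\<Sum>x<budget I k. c)"
      "agree_off (writes (sum_loop aLin aI aBud ?e7)) s6 s7"
    by (rule runsE)
  note f7 = f6 agree_offD[OF e7(4)]

  let ?e8 = "cell aLin"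
  have v8: "val ?e8 \<rho> = budget I k * c" if "agree_off {aI, aThr} s7 \<rho>" for \<rho>
    using e7(3) by (simp add: agree_offD[OF that])
  have "runs (sum_loop aThr aI aBud ?e8) s7 ((cost ?e8 + 26) * X)
      (\<lambda>\<tau>. \<tau> aThr 0 = 0 + (\<Sum>x<budget I k. budget I k * c))"
    by (rule runs_sum_loop[where f = "\<lambda>x. budget I k * c", OF _ _ _ _ v8])
      (use e6(3) zero nX bX in \<open>simp_all add: f7\<close>)
  then obtain t8 s8 where e8: "exec (sum_loop aThr aI aBud ?e8) s7 t8 s8"
      "t8 \<le> (cost ?e8 + 26) * X" "s8 aThr 0 = 0 + (\<Sum>x<budget I k. budget I k * c)"
      "agree_off (writes (sum_loop aThr aI aBud ?e8)) s7 s8"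
    by (rule runsE)
  note f8 = f7 agree_offD[OF e8(4)]
  have thr: "s8 aThr 0 = threshold c I k"
    using e8(3) by (simp add: threshold_def)

  let ?e9 = "Plus (cell aThr) (Const 1)"
  have v9: "val ?e9 \<rho> = threshold c I k + 1" if "agree_off {aI, aCore} s8 \<rho>" for \<rho>
    by (simp add: agree_offD[OF that] thr)
  have "runs (sum_loop aCore aI aBud ?e9) s8 ((cost ?e9 + 26) * X)
      (\<lambda>\<tau>. \<tau> aCore 0 = 0 + (\<Sum>x<budget I k. threshold c I k + 1))"
    by (rule runs_sum_loop[where f = "\<lambda>x. threshold c I k + 1", OF _ _ _ _ v9])
      (use e6(3) zero nX bX in \<open>simp_all add: f8\<close>)
  then obtain t9 s9 where e9: "exec (sum_loop aCore aI aBud ?e9) s8 t9 s9"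
      "t9 \<le> (cost ?e9 + 26) * X" "s9 aCore 0 = 0 + (\<Sum>x<budget I k. threshold c I k + 1)"
      "agree_off (writes (sum_loop aCore aI aBud ?e9)) s8 s9"
    by (rule runsE)
  note f9 = f8 agree_offD[OF e9(4)]

  \<comment> \<open>The truncated excess of a degree over the threshold is positive exactly at a
    hub, so the sum vanishes iff there is none.\<close>
  let ?e10 = "Minus (Get aDeg (cell aI)) (cell aThr)"
  have v10: "val ?e10 \<rho> = deg I x - threshold c I k"
    if "x < n" "\<rho> aI 0 = x" "agree_off {aI, aHub} s9 \<rho>" for \<rho> x
    using that(1,2) by (simp add: agree_offD[OF that(3)] f9 thr degs)
  have "runs (sum_loop aHub aI aOrd ?e10) s9 ((cost ?e10 + 26) * X)
      (\<lambda>\<tau>. \<tau> aHub 0 = 0 + (\<Sum>x<n. deg I x - threshold c I k))"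
    by (rule runs_sum_loop[where f = "\<lambda>x. deg I x - threshold c I k", OF _ _ _ _ v10])
      (use e1(3) zero nX bX in \<open>simp_all add: f9\<close>)
  then obtain t10 s10 where e10: "exec (sum_loop aHub aI aOrd ?e10) s9 t10 s10"
      "t10 \<le> (cost ?e10 + 26) * X" "s10 aHub 0 = 0 + (\<Sum>x<n. deg I x - threshold c I k)"
      "agree_off (writes (sum_loop aHub aI aOrd ?e10)) s9 s10"
    by (rule runsE)
  note f10 = f9 agree_offD[OF e10(4)]
  have hub: "s10 aHub 0 = 0 \<longleftrightarrow> \<not> has_hub c I k"
  proof -
    have "s10 aHub 0 = 0 \<longleftrightarrow> (\<forall>x<n. deg I x \<le> threshold c I k)"
      using e10(3) by auto
    then show ?thesis
      by (metis has_hub_def n_def not_le)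
  qed

  \<comment> \<open>The entry of \<open>x\<close> counts the core vertices \<open>y\<close> that are
    equal or adjacent to \<open>x\<close>; later only its being nonzero matters. The hub flag comes
    in here, which empties the kept set in the hub case.\<close>
  let ?e11 = "both (both (Minus (Const 1) (cell aHub)) (Minus (cell aCore) (Get aRank (cell aJ))))
        (Plus (adj_expr (cell aJ) (cell aI)) (Minus (Const 1) (differ (cell aI) (cell aJ))))"
  have v11: "val ?e11 \<rho> = of_bool (y \<in> core c I k \<and> (y = x \<or> adj I y x))"
    if "x < n" "y < n" "\<rho> aI 0 = x" "\<rho> aJ 0 = y" "agree_off {aI, aJ, aKept} s10 \<rho>" for \<rho> x y
  proof -
    have "val (differ (cell aI) (cell aJ)) \<rho> = 0 \<longleftrightarrow> y = x"
      using that(3,4) by auto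
    moreover have "val (adj_expr (cell aJ) (cell aI)) \<rho> = of_bool (adj I y x)"
      using that(1-4) by (simp add: adj_val agree_offD[OF that(5)] f10)
    moreover have "\<rho> aHub 0 = 0 \<longleftrightarrow> \<not> has_hub c I k"
      "\<rho> aCore 0 = budget I k * (threshold c I k + 1)" "\<rho> aRank y = rank I y"
      using that(2) hub e9(3) by (simp_all add: agree_offD[OF that(5)] f10 ranks)
    ultimately show ?thesis
      using that(2,4) by (auto simp: core_def n_def simp del: val_differ)
  qed
  have "runs (table_loop aKept aI aJ aOrd ?e11) s10 ((cost ?e11 + 49) * X)
      (\<lambda>\<tau>. \<forall>x<n. \<tau> aKept x = (\<Sum>y<n. of_bool (y \<in> core c I k \<and> (y = x \<or> adj I y x))))"
    by (rule runs_table_loop[where f = "\<lambda>x y. of_bool (y \<in> core c I k \<and> (y = x \<or> adj I y x))", OF _ _ _ _ v11])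
      (use e1(3) zero nX in \<open>simp_all add: f10\<close>)
  then obtain t11 s11 where e11: "exec (table_loop aKept aI aJ aOrd ?e11) s10 t11 s11"
      "t11 \<le> (cost ?e11 + 49) * X" "\<forall>x<n. s11 aKept x = (\<Sum>y<n. of_bool (y \<in> core c I k \<and> (y = x \<or> adj I y x)))"
      "agree_off (writes (table_loop aKept aI aJ aOrd ?e11)) s10 s11"
    by (rule runsE)
  note f11 = f10 agree_offD[OF e11(4)]
  have kept: "s11 aKept x = 0 \<longleftrightarrow> x \<notin> kept c I k" if "x < n" for x
    using that e11(3) by (auto simp: kept_def core_def n_def)

  let ?e12 = "both (Minus (cell aI) (cell aJ)) (Get aKept (cell aJ))"
  have v12: "val ?e12 \<rho> = of_bool (y \<in> kept c I k \<and> y < x)"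
    if "x < n" "y < n" "\<rho> aI 0 = x" "\<rho> aJ 0 = y" "agree_off {aI, aJ, aPos} s11 \<rho>" for \<rho> x y
    using that(1-4) by (auto simp: agree_offD[OF that(5)] kept)
  have "runs (table_loop aPos aI aJ aOrd ?e12) s11 ((cost ?e12 + 49) * X)
      (\<lambda>\<tau>. \<forall>x<n. \<tau> aPos x = (\<Sum>y<n. of_bool (y \<in> kept c I k \<and> y < x)))"
    by (rule runs_table_loop[where f = "\<lambda>x y. of_bool (y \<in> kept c I k \<and> y < x)", OF _ _ _ _ v12])
      (use e1(3) zero nX in \<open>simp_all add: f11\<close>)
  then obtain t12 s12 where e12: "exec (table_loop aPos aI aJ aOrd ?e12) s11 t12 s12"
      "t12 \<le> (cost ?e12 + 49) * X" "\<forall>x<n. s12 aPos x = (\<Sum>y<n. of_bool (y \<in> kept c I k \<and> y < x))"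
      "agree_off (writes (table_loop aPos aI aJ aOrd ?e12)) s11 s12"
    by (rule runsE)
  note f12 = f11 agree_offD[OF e12(4)]
  have "{y. y < n \<and> y \<in> kept c I k \<and> y < x} = {y \<in> kept c I k. y < x}" for x
    using kept_subset by (auto simp: n_def)
  then have pos: "s12 aPos x = position (kept c I k) x" if "x < n" for x
    using e12(3) that by (simp only: sum_of_bool_card position_def)

  let ?e13 = "truth (Get aKept (cell aI))"
  have v13: "val ?e13 \<rho> = of_bool (x \<in> kept c I k)"
    if "x < n" "\<rho> aI 0 = x" "agree_off {aI, aCard} s12 \<rho>" for \<rho> x
    using that(1,2) by (auto simp: agree_offD[OF that(3)] f12 kept)
  have "runs (sum_loop aCard aI aOrd ?e13) s12 ((cost ?e13 + 26) * X)
      (\<lambda>\<tau>. \<tau> aCard 0 = 0 + (\<Sum>x<n. of_bool (x \<in> kept c I k)))"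
    by (rule runs_sum_loop[where f = "\<lambda>x. of_bool (x \<in> kept c I k)", OF _ _ _ _ v13])
      (use e1(3) zero nX bX in \<open>simp_all add: f12\<close>)
  then obtain t13 s13 where e13: "exec (sum_loop aCard aI aOrd ?e13) s12 t13 s13"
      "t13 \<le> (cost ?e13 + 26) * X" "s13 aCard 0 = 0 + (\<Sum>x<n. of_bool (x \<in> kept c I k))"
      "agree_off (writes (sum_loop aCard aI aOrd ?e13)) s12 s13"
    by (rule runsE)
  note f13 = f12 agree_offD[OF e13(4)]
  have "{y. y < n \<and> y \<in> kept c I k} = kept c I k"
    using kept_subset by (auto simp: n_def)
  then have card: "s13 aCard 0 = card (kept c I k)"
    using e13(3) by (simp only: sum_of_bool_card add_0)

  have "prepared c I k s13"
    using e1(3) e2(3) row ranks hub kept pos card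
    by (simp add: prepared_def f13 n_def)
  moreover have "exec (prepare c) \<sigma>
      (t1 + (t2 + (t3 + (t4 + (t5 + (t6 + (t7 + (t8 + (t9 + (t10 + (t11 + (t12 + t13)))))))))))) s13"
    unfolding prepare_def
    by (rule exec.Seq[OF e1(1)] exec.Seq[OF e2(1)] exec.Seq[OF e3(1)] exec.Seq[OF e4(1)]
      exec.Seq[OF e5(1)] exec.Seq[OF e6(1)] exec.Seq[OF e7(1)] exec.Seq[OF e8(1)] exec.Seq[OF e9(1)]
      exec.Seq[OF e10(1)] exec.Seq[OF e11(1)] exec.Seq[OF e12(1)] e13(1))+
  moreover have "t1 + (t2 + (t3 + (t4 + (t5 + (t6 + (t7 + (t8 + (t9 + (t10 + (t11 + (t12 + t13)))))))))))
      \<le> 1000 * X"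
    using e1(2) e2(2) e3(2) e4(2) e5(2) e6(2) e7(2) e8(2) e9(2) e10(2) e11(2) e12(2) e13(2)
    by simp
  ultimately show ?thesis
    unfolding runs_def X_def by blast
qed

section \<open>Writing out the reduced graph\<close>

definition invert_positions :: com where
  "invert_positions = For aI aOrd (Put aInv (Get aPos (cell aI)) (cell aI))"

lemma writes_invert_positions [simp]: "writes invert_positions = {aI, aInv}"
  by (simp add: invert_positions_def)

text \<open>Vertices outside the kept set write too, without a test. Such a vertex writes to the
  slot of the next kept vertex, if any, which overwrites it later; and by
  \<open>position_less\<close> no vertex writes to the slot of a smaller kept vertex.\<close>

lemma runs_invert_positions:
  assumes "prepared c I k \<sigma>"
  shows "runs invert_positions \<sigma> (word_order I * 18 + 9)
    (\<lambda>\<tau>. \<forall>i<card (kept c I k). \<tau> aInv i = inv_into (kept c I k) (position (kept c I k)) i)"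
proof -
  define K where "K = kept c I k"
  define n where "n = word_order I"
  have "finite K" and K: "K \<subseteq> {..<n}"
    unfolding K_def n_def by (rule finite_kept kept_subset)+
  have "runs invert_positions \<sigma> (n * (6 + 12) + 9) (\<lambda>\<tau>. \<forall>x<n. x \<in> K \<longrightarrow> \<tau> aInv (position K x) = x)"
    unfolding invert_positions_def
  proof (rule runs_For[where Inv = "\<lambda>j \<tau>. \<forall>x<j. x \<in> K \<longrightarrow> \<tau> aInv (position K x) = x"])
    fix j \<rho>
    assume j: "j < n" "\<forall>x<j. x \<in> K \<longrightarrow> \<rho> aInv (position K x) = x" "\<rho> aI 0 = j"
      "agree_off (insert aI (writes (Put aInv (Get aPos (cell aI)) (cell aI)))) \<sigma> \<rho>"
    have "\<rho> aPos j = position K j"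
      using assms j(1) by (simp add: agree_offD[OF j(4)] prepared_def n_def K_def)
    then show "runs (Put aInv (Get aPos (cell aI)) (cell aI)) \<rho> 6
        (\<lambda>\<tau>. \<forall>x<Suc j. x \<in> K \<longrightarrow> (\<tau>(aI := (\<tau> aI)(0 := Suc j))) aInv (position K x) = x)"
      using j position_less[OF \<open>finite K\<close>] by (intro runs_Put) (force simp: less_Suc_eq)+
  qed (use assms in \<open>auto simp: prepared_def n_def\<close>)
  then show ?thesis
    unfolding K_def[symmetric] n_def[symmetric]
  proof (rule runs_conseq)
    fix \<tau>
    assume *: "\<forall>x<n. x \<in> K \<longrightarrow> \<tau> aInv (position K x) = x"
    have bij: "bij_betw (position K) K {..<card K}"
      using \<open>finite K\<close> by (rule bij_betw_position)
    show "\<forall>i<card K. \<tau> aInv i = inv_into K (position K) i"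
    proof (intro allI impI)
      fix i
      assume "i < card K"
      then obtain x where "x \<in> K" "i = position K x"
        using bij by (auto simp: bij_betw_def)
      then show "\<tau> aInv i = inv_into K (position K) i"
        using * K bij by (auto simp: bij_betw_def)
    qed
  qed simp
qed

definition emit_edge :: com where
  "emit_edge = Seq
    (Put 0 (Plus (cell aOut) (Const 1)) (adj_expr (Get aInv (cell aI)) (Get aInv (cell aJ))))
    (Put aOut (Const 0) (Plus (cell aOut) (Const 1)))"

lemma writes_emit_edge [simp]: "writes emit_edge = {0, aOut}"
  by (auto simp: emit_edge_def)

lemma runs_emit:
  fixes I c k
  defines "K \<equiv> kept c I k"
  defines "f \<equiv> inv_into K (position K)"
  defines "N \<equiv> card K"
  assumes "prepared c I k \<sigma>" and inv: "\<forall>i<N. \<sigma> aInv i = f i" and "\<sigma> aOut 0 = 0"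
  shows "runs (For aI aCard (For aJ aCard emit_edge)) \<sigma> (N * (N * 68 + 21) + 9)
    (\<lambda>\<tau>. \<tau> aOut 0 = N * N \<and> (\<forall>p<N * N. \<tau> 0 (Suc p) = of_bool (adj I (f (p div N)) (f (p mod N)))))"
proof -
  have range: "f i < word_order I" if "i < N" for i
    using that bij_betw_position[of K] kept_subset[of c I k]
      inv_into_into[of i "position K" K]
    by (auto simp: f_def N_def K_def bij_betw_def)
  \<comment> \<open>Indexed by the number \<open>q\<close> of letters already written,
    \<open>G\<close> is the invariant of both loops. The cursor \<open>aOut\<close> equals
    \<open>a * N + b\<close>, so row and column are recovered by \<open>div\<close> and
    \<open>mod\<close> although the program never multiplies.\<close>
  define G where "G q \<tau> \<longleftrightarrow> \<tau> aOut 0 = q \<and>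
    (\<forall>p<q. \<tau> 0 (Suc p) = of_bool (adj I (f (p div N)) (f (p mod N))))" for q and \<tau> :: store
  have G_upd: "G q (\<tau>(a := h)) = G q \<tau>" if "a \<noteq> 0" "a \<noteq> aOut" for q \<tau> a h
    using that by (simp add: G_def)
  have inner: "runs (For aJ aCard emit_edge) \<rho> (N * (56 + 12) + 9) (G (a * N + N))"
    if a: "a < N" "G (a * N) \<rho>" "\<rho> aI 0 = a" "agree_off {0, aI, aJ, aOut} \<sigma> \<rho>" for a \<rho>
  proof (rule runs_For[where Inv = "\<lambda>b. G (a * N + b)"])
    show "\<rho> aCard 0 = N"
      using assms(4) by (simp add: agree_offD[OF a(4)] prepared_def N_def K_def)
    show "G (a * N + 0) (\<rho>(aJ := (\<rho> aJ)(0 := 0)))"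
      using a(2) by (simp add: G_upd)
    fix b \<rho>'
    assume b: "b < N" "G (a * N + b) \<rho>'" "\<rho>' aJ 0 = b" "agree_off (insert aJ (writes emit_edge)) \<rho> \<rho>'"
    have frame: "\<rho>' x = \<sigma> x" if "x \<notin> {0, aI, aJ, aOut}" for x
      using that agree_offD[OF b(4), of x] agree_offD[OF a(4), of x] by simp
    have "\<rho>' aI 0 = a"
      using agree_offD[OF b(4), of aI] a(3) by simp
    then have ends: "val (Get aInv (cell aI)) \<rho>' = f a" "val (Get aInv (cell aJ)) \<rho>' = f b"
      using a(1) b(1,3) inv by (simp_all add: frame)
    then have edge: "val (adj_expr (Get aInv (cell aI)) (Get aInv (cell aJ))) \<rho>' = of_bool (adj I (f a) (f b))"
      using assms(4) range[OF a(1)] range[OF b(1)]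
      by (subst val_adj_expr[where I = I]) (simp_all add: frame prepared_def)
    have "(a * N + b) div N = a" "(a * N + b) mod N = b"
      using b(1) by simp_all
    moreover have "\<rho>' aOut 0 = a * N + b"
      using b(2) by (simp add: G_def)
    ultimately have "runs emit_edge \<rho>' (50 + 6) (\<lambda>\<tau>. G (a * N + Suc b) (\<tau>(aJ := (\<tau> aJ)(0 := Suc b))))"
      unfolding emit_edge_def using b(2)
      by (intro runs_Seq runs_store[OF _ edge] runs_store[of "Const 0" _ 0]) (auto simp: G_def less_Suc_eq)
    then show "runs emit_edge \<rho>' 56 (\<lambda>\<tau>. G (a * N + Suc b) (\<tau>(aJ := (\<tau> aJ)(0 := Suc b))))"
      by simp
  qed auto
  have "runs (For aI aCard (For aJ aCard emit_edge)) \<sigma> (N * (N * (56 + 12) + 9 + 12) + 9) (G (N * N))"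
  proof (rule runs_For[where Inv = "\<lambda>a. G (a * N)"])
    fix a \<rho>
    assume a: "a < N" "G (a * N) \<rho>" "\<rho> aI 0 = a" "agree_off (insert aI (writes (For aJ aCard emit_edge))) \<sigma> \<rho>"
    have "agree_off {0, aI, aJ, aOut} \<sigma> \<rho>"
      using a(4) by (simp add: insert_commute)
    then show "runs (For aJ aCard emit_edge) \<rho> (N * (56 + 12) + 9)
        (\<lambda>\<tau>. G (Suc a * N) (\<tau>(aI := (\<tau> aI)(0 := Suc a))))"
      using inner[OF a(1-3)] by (simp add: G_upd add.commute)
  qed (use assms in \<open>auto simp: prepared_def G_def\<close>)
  then show ?thesis
    by (rule runs_conseq) (simp_all add: G_def)
qed

text \<open>There is no branch for the hub case: with no kept vertices the loops do nothing and the
  last assignment sets the length to 0. Letters of the input beyond the new length are cut off by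
  \<open>array_word\<close>, and the parameter stays in place.\<close>

definition reduction :: "nat \<Rightarrow> com" where
  "reduction c = Seq (prepare c) (Seq invert_positions
    (Seq (For aI aCard (For aJ aCard emit_edge)) (Put 0 (Const 0) (cell aOut))))"

lemma array_word_eqI:
  assumes "m 0 = l" "\<And>i. i < l \<Longrightarrow> m (Suc i) \<noteq> 0 \<longleftrightarrow> w i"
  shows "array_word m = map w [0..<l]"
  using assms by (simp add: array_word_def)

lemma runs_reduction:
  assumes "\<sigma> 0 = word_array I" "\<sigma> 1 0 = k" "\<And>a x. 5 \<le> a \<Longrightarrow> \<sigma> a x = 0"
  shows "runs (reduction c) \<sigma> (2000 * (length I + 1)\<^sup>2)
    (\<lambda>\<tau>. array_word (\<tau> 0) = reduced c I k \<and> \<tau> 1 0 = k)"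
proof -
  define K where "K = kept c I k"
  define f where "f = inv_into K (position K)"
  define N where "N = card K"
  obtain t1 s1 where e1: "exec (prepare c) \<sigma> t1 s1" "t1 \<le> 1000 * (length I + 1)\<^sup>2" "prepared c I k s1"
      "agree_off (writes (prepare c)) \<sigma> s1"
    using runs_prepare[OF assms] by (rule runsE)
  have f1: "s1 a = \<sigma> a" if "a \<notin> {5..20}" for a
    using that agree_offD[OF e1(4)] writes_prepare by blast
  obtain t2 s2 where e2: "exec invert_positions s1 t2 s2" "t2 \<le> word_order I * 18 + 9"
      "\<forall>i<N. s2 aInv i = f i" "agree_off (writes invert_positions) s1 s2"
    using runs_invert_positions[OF e1(3)] unfolding N_def f_def K_def by (rule runsE)
  note f2 = agree_offD[OF e2(4)]
  have "prepared c I k s2"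
    using e1(3) by (simp add: prepared_def f2)
  moreover have "s2 aOut 0 = 0"
    using assms(3) by (simp add: f2 f1)
  ultimately have "runs (For aI aCard (For aJ aCard emit_edge)) s2 (N * (N * 68 + 21) + 9)
    (\<lambda>\<tau>. \<tau> aOut 0 = N * N \<and> (\<forall>p<N * N. \<tau> 0 (Suc p) = of_bool (adj I (f (p div N)) (f (p mod N)))))"
    using e2(3) unfolding N_def f_def K_def by (intro runs_emit)
  then obtain t3 s3 where e3: "exec (For aI aCard (For aJ aCard emit_edge)) s2 t3 s3"
      "t3 \<le> N * (N * 68 + 21) + 9" "s3 aOut 0 = N * N"
      "\<forall>p<N * N. s3 0 (Suc p) = of_bool (adj I (f (p div N)) (f (p mod N)))"
      "agree_off (writes (For aI aCard (For aJ aCard emit_edge))) s2 s3"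
    by (auto elim: runsE)
  let ?\<tau> = "s3(0 := (s3 0)(0 := N * N))"
  have e4: "exec (Put 0 (Const 0) (cell aOut)) s3 4 ?\<tau>"
    using exec.Put[of 0 "Const 0" "cell aOut" s3] e3(3) by (simp add: eval_nat_numeral)
  have "exec (reduction c) \<sigma> (t1 + (t2 + (t3 + 4))) ?\<tau>"
    unfolding reduction_def by (rule exec.Seq[OF e1(1)] exec.Seq[OF e2(1)] exec.Seq[OF e3(1)] e4)+
  moreover have "array_word (?\<tau> 0) = reduced c I k"
    unfolding reduced_def Let_def K_def[symmetric] f_def[symmetric] N_def[symmetric]
    using e3(4) by (intro array_word_eqI) auto
  moreover have "?\<tau> 1 0 = k"
    using assms(2) by (simp add: agree_offD[OF e3(5)] f2 f1)
  moreover have "t1 + (t2 + (t3 + 4)) \<le> 2000 * (length I + 1)\<^sup>2"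
  proof -
    have "N \<le> length I"
      using card_kept_le word_order_le unfolding N_def K_def by (rule le_trans)
    then have "N * N \<le> (length I + 1)\<^sup>2" "N \<le> (length I + 1)\<^sup>2" "1 \<le> (length I + 1)\<^sup>2"
      "word_order I \<le> (length I + 1)\<^sup>2"
      using mult_le_mono[of N "length I" N "length I"] word_order_le[of I]
      by (simp_all add: power2_eq_square)
    moreover have "N * (N * 68 + 21) + 9 = 68 * (N * N) + 21 * N + 9"
      by (simp add: algebra_simps)
    ultimately show ?thesis
      using e1(2) e2(2) e3(2) by linarith
  qed
  ultimately show ?thesis
    unfolding runs_def by blast
qed

text \<open>The kept set is recomputed from the input graph. A position beyond the end of the given
  solution reads 0 from its array, in accordance with the convention that missing letters count as
  \<open>False\<close>.\<close>

definition lifting :: "nat \<Rightarrow> com" where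
  "lifting c = Seq (prepare c) (Seq
    (For aI aOrd (Put 0 (Plus (cell aI) (Const 1))
      (Plus (both (cell aHub) (Minus (cell 1) (Get aRank (cell aI))))
        (both (Get aKept (cell aI)) (Get 4 (Plus (Get aPos (cell aI)) (Const 1)))))))
    (Put 0 (Const 0) (cell aOrd)))"

lemma runs_lifting:
  assumes "\<sigma> 0 = word_array I" "\<sigma> 1 0 = k" "\<And>a x. 5 \<le> a \<Longrightarrow> \<sigma> a x = 0" "\<sigma> 4 = word_array s"
  shows "runs (lifting c) \<sigma> (2000 * (length I + 1)\<^sup>2) (\<lambda>\<tau>. array_word (\<tau> 0) = lifted c I k s)"
proof -
  define n where "n = word_order I"
  define g where "g v \<longleftrightarrow> has_hub c I k \<and> rank I v < k \<or>
    v \<in> kept c I k \<and> position (kept c I k) v < length s \<and> s ! position (kept c I k) v" for v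
  obtain t1 s1 where e1: "exec (prepare c) \<sigma> t1 s1" "t1 \<le> 1000 * (length I + 1)\<^sup>2" "prepared c I k s1"
      "agree_off (writes (prepare c)) \<sigma> s1"
    using runs_prepare[OF assms(1-3)] by (rule runsE)
  have f1: "s1 a = \<sigma> a" if "a \<notin> {5..20}" for a
    using that agree_offD[OF e1(4)] writes_prepare by blast
  let ?e = "Plus (both (cell aHub) (Minus (cell 1) (Get aRank (cell aI))))
    (both (Get aKept (cell aI)) (Get 4 (Plus (Get aPos (cell aI)) (Const 1))))"
  let ?l = "For aI aOrd (Put 0 (Plus (cell aI) (Const 1)) ?e)"
  have "runs ?l s1 (n * (45 + 12) + 9) (\<lambda>\<tau>. \<forall>v<n. \<tau> 0 (Suc v) \<noteq> 0 \<longleftrightarrow> g v)"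
  proof (rule runs_For[where Inv = "\<lambda>j \<tau>. \<forall>v<j. \<tau> 0 (Suc v) \<noteq> 0 \<longleftrightarrow> g v"])
    fix j \<rho>
    assume j: "j < n" "\<forall>v<j. \<rho> 0 (Suc v) \<noteq> 0 \<longleftrightarrow> g v" "\<rho> aI 0 = j"
      "agree_off (insert aI (writes (Put 0 (Plus (cell aI) (Const 1)) ?e))) s1 \<rho>"
    have "\<rho> 1 0 = k" "\<rho> 4 = word_array s" "\<rho> aHub 0 = 0 \<longleftrightarrow> \<not> has_hub c I k" "\<rho> aRank j = rank I j"
      "\<rho> aKept j = 0 \<longleftrightarrow> j \<notin> kept c I k" "\<rho> aPos j = position (kept c I k) j"
      using e1(3) assms j(1) by (auto simp: agree_offD[OF j(4)] f1 prepared_def n_def)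
    then have "val ?e \<rho> \<noteq> 0 \<longleftrightarrow> g j"
      using j(3) by (auto simp: g_def word_array_def)
    then obtain y where "val ?e \<rho> = y" "y \<noteq> 0 \<longleftrightarrow> g j"
      by blast
    then show "runs (Put 0 (Plus (cell aI) (Const 1)) ?e) \<rho> 45
        (\<lambda>\<tau>. \<forall>v<Suc j. (\<tau>(aI := (\<tau> aI)(0 := Suc j))) 0 (Suc v) \<noteq> 0 \<longleftrightarrow> g v)"
      using j(2,3) by (intro runs_store[of _ _ "Suc j" _ y]) (auto simp: less_Suc_eq)
  qed (use e1(3) in \<open>auto simp: prepared_def n_def\<close>)
  then obtain t2 s2 where e2: "exec ?l s1 t2 s2" "t2 \<le> n * (45 + 12) + 9"
      "\<forall>v<n. s2 0 (Suc v) \<noteq> 0 \<longleftrightarrow> g v" "agree_off (writes ?l) s1 s2"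
    by (rule runsE)
  have "s2 aOrd 0 = n"
    using e1(3) by (simp add: agree_offD[OF e2(4)] prepared_def n_def)
  then have e3: "exec (Put 0 (Const 0) (cell aOrd)) s2 4 (s2(0 := (s2 0)(0 := n)))"
    using exec.Put[of 0 "Const 0" "cell aOrd" s2] by (simp add: eval_nat_numeral)
  have "exec (lifting c) \<sigma> (t1 + (t2 + 4)) (s2(0 := (s2 0)(0 := n)))"
    unfolding lifting_def by (rule exec.Seq[OF e1(1)] exec.Seq[OF e2(1)] e3)+
  moreover have "array_word ((s2(0 := (s2 0)(0 := n))) 0) = lifted c I k s"
    unfolding lifted_def g_def[symmetric] n_def[symmetric]
    using e2(3) by (intro array_word_eqI) auto
  moreover have "t1 + (t2 + 4) \<le> 2000 * (length I + 1)\<^sup>2"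
  proof -
    have "n \<le> (length I + 1)\<^sup>2" "1 \<le> (length I + 1)\<^sup>2"
      using word_order_le[of I] by (simp_all add: power2_eq_square n_def)
    moreover have "t2 \<le> 57 * n + 9"
      using e2(2) by simp
    ultimately show ?thesis
      using e1(2) by linarith
  qed
  ultimately show ?thesis
    unfolding runs_def by blast
qed

section \<open>Correctness of the kernel\<close>

definition covered :: "'v set set \<Rightarrow> 'v set \<Rightarrow> nat" where
  "covered E S = card {e \<in> E. e \<inter> S \<noteq> {}}"

lemma adj_sym: "adj I u v \<longleftrightarrow> adj I v u"
  by (auto simp: adj_def)

lemma word_edges_iff:
  "e \<in> word_edges I \<longleftrightarrow> (\<exists>u v. e = {u, v} \<and> u < word_order I \<and> v < word_order I \<and> adj I u v)"
  unfolding word_edges_def adj_def by (simp, safe) (metis insert_commute)+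

lemma pair_in_word_edges:
  "{u, v} \<in> word_edges I \<longleftrightarrow> u < word_order I \<and> v < word_order I \<and> adj I u v"
  unfolding word_edges_iff by (auto simp: doubleton_eq_iff adj_sym)

lemma finite_word_edges [simp]: "finite (word_edges I)"
  by (rule finite_subset[of _ "Pow {..<word_order I}"]) (auto simp: word_edges_def)

text \<open>The newly covered edges are those from \<open>v\<close> to its neighbours outside
  \<open>S\<close>. The exact count serves both degree sum bounds as well as the exchange
  argument.\<close>

lemma covered_insert:
  assumes "v < word_order I"
  shows "covered (word_edges I) (insert v S) = covered (word_edges I) S +
    (if v \<in> S then 0 else card {u. u < word_order I \<and> adj I v u \<and> u \<notin> S})"
proof (cases "v \<in> S")
  case False
  let ?U = "{u. u < word_order I \<and> adj I v u \<and> u \<notin> S}"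
  have "{e \<in> word_edges I. e \<inter> insert v S \<noteq> {}} =
    {e \<in> word_edges I. e \<inter> S \<noteq> {}} \<union> (\<lambda>u. {v, u}) ` ?U"
  proof (intro equalityI subsetI)
    fix e
    assume "e \<in> {e \<in> word_edges I. e \<inter> insert v S \<noteq> {}}"
    then show "e \<in> {e \<in> word_edges I. e \<inter> S \<noteq> {}} \<union> (\<lambda>u. {v, u}) ` ?U"
      by (auto simp: word_edges_iff image_iff adj_sym)
  qed (use assms in \<open>auto simp: pair_in_word_edges\<close>)
  moreover have "{e \<in> word_edges I. e \<inter> S \<noteq> {}} \<inter> (\<lambda>u. {v, u}) ` ?U = {}"
    using False by auto
  moreover have "inj_on (\<lambda>u. {v, u}) ?U"
    by (auto simp: inj_on_def doubleton_eq_iff)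
  ultimately show ?thesis
    using False by (simp add: covered_def card_Un_disjoint card_image)
qed (simp add: insert_absorb)

lemma covered_insert_le:
  assumes "v < word_order I"
  shows "covered (word_edges I) (insert v S) \<le> covered (word_edges I) S + deg I v"
proof -
  have "card {u. u < word_order I \<and> adj I v u \<and> u \<notin> S} \<le> deg I v"
    unfolding deg_def by (intro card_mono) auto
  then show ?thesis
    by (simp add: covered_insert[OF assms])
qed

lemma covered_le_sum_deg:
  assumes "S \<subseteq> {..<word_order I}"
  shows "covered (word_edges I) S \<le> (\<Sum>v\<in>S. deg I v)"
proof -
  have "finite S"
    using assms finite_subset by blast
  then show ?thesis
    using assms
  proof (induction S rule: finite_induct)
    case (insert v S)
    then show ?case
      using covered_insert_le[of v I S] by simp
  qed (simp add: covered_def)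
qed

text \<open>A new vertex has at most \<open>card S\<close> of its edges already covered, and
  \<open>s * s + s\<close> is at most the square of \<open>s + 1\<close>.\<close>

lemma sum_deg_le_covered:
  assumes "S \<subseteq> {..<word_order I}"
  shows "(\<Sum>v\<in>S. deg I v) \<le> covered (word_edges I) S + card S * card S"
proof -
  have "finite S"
    using assms finite_subset by blast
  then show ?thesis
    using assms
  proof (induction S rule: finite_induct)
    case (insert v S)
    have "{u. u < word_order I \<and> adj I v u} \<subseteq> {u. u < word_order I \<and> adj I v u \<and> u \<notin> S} \<union> S"
      by blast
    then have "deg I v \<le> card ({u. u < word_order I \<and> adj I v u \<and> u \<notin> S} \<union> S)"
      unfolding deg_def using insert.hyps by (intro card_mono) auto
    also have "\<dots> \<le> card {u. u < word_order I \<and> adj I v u \<and> u \<notin> S} + card S"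
      by (rule card_Un_le)
    finally show ?case
      using insert by (simp add: covered_insert)
  qed simp
qed

section \<open>Ranks in the degree order\<close>

lemma precedes_irrefl: "\<not> precedes I v v"
  by (simp add: precedes_def)

lemma precedes_trans: "precedes I u v \<Longrightarrow> precedes I v w \<Longrightarrow> precedes I u w"
  by (cases "v \<le> u"; cases "w \<le> v"; cases "w \<le> u") (simp_all add: precedes_def)

lemma precedes_total: "u \<noteq> v \<Longrightarrow> precedes I u v \<or> precedes I v u"
  by (auto simp: precedes_def)

lemma rank_strict_mono:
  assumes "precedes I u v" "u < word_order I"
  shows "rank I u < rank I v"
  unfolding rank_def
proof (rule psubset_card_mono)
  show "{x. x < word_order I \<and> precedes I x u} \<subset> {x. x < word_order I \<and> precedes I x v}"
    using assms precedes_irrefl precedes_trans by blast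
qed simp

lemma deg_le_of_rank_less:
  assumes "rank I u < rank I v" "u < word_order I" "v < word_order I"
  shows "deg I v \<le> deg I u"
proof -
  have "precedes I u v"
    using assms rank_strict_mono precedes_total by (metis less_asym nat_neq_iff)
  then show ?thesis
    by (simp add: precedes_def)
qed

text \<open>In a finite strict total order the numbers of predecessors are pairwise distinct and
  below the number of elements, so every number below it occurs.\<close>

lemma bij_betw_rank: "bij_betw (rank I) {..<word_order I} {..<word_order I}"
proof -
  have inj: "inj_on (rank I) {..<word_order I}"
    by (rule inj_onI) (metis lessThan_iff nat_neq_iff precedes_total rank_strict_mono)
  have "rank I v < card {..<word_order I}" if "v < word_order I" for v
    unfolding rank_def
  proof (rule psubset_card_mono)
    show "{u. u < word_order I \<and> precedes I u v} \<subset> {..<word_order I}"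
      using that precedes_irrefl by blast
  qed simp
  then have "rank I ` {..<word_order I} = {..<word_order I}"
    using inj by (intro card_subset_eq) (auto simp: card_image)
  with inj show ?thesis
    by (simp add: bij_betw_def)
qed

lemma card_rank_less: "card {v. v < word_order I \<and> rank I v < m} = min m (word_order I)"
proof -
  have "rank I ` {v. v < word_order I \<and> rank I v < m} = {..<min m (word_order I)}"
  proof (intro equalityI subsetI)
    fix i
    assume i: "i \<in> {..<min m (word_order I)}"
    then obtain v where "v < word_order I" "i = rank I v"
      using bij_betw_rank[of I] unfolding bij_betw_def
      by (metis imageE lessThan_iff min_less_iff_conj)
    with i show "i \<in> rank I ` {v. v < word_order I \<and> rank I v < m}"
      by auto
  qed (use bij_betw_rank[of I] in \<open>auto simp: bij_betw_def\<close>)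
  moreover have "inj_on (rank I) {v. v < word_order I \<and> rank I v < m}"
    using bij_betw_rank[of I] by (auto simp: bij_betw_def inj_on_def)
  ultimately show ?thesis
    by (metis card_image card_lessThan)
qed

text \<open>Since \<open>S\<close> is no larger than the top set, its part outside the top set
  injects into the top vertices missing from \<open>S\<close>, and no degree drops along this
  injection because ranks do.\<close>

lemma sum_deg_le_top:
  assumes "S \<subseteq> {..<word_order I}" "card S \<le> k"
  shows "(\<Sum>v\<in>S. deg I v) \<le> (\<Sum>v | v < word_order I \<and> rank I v < k. deg I v)"
proof -
  let ?T = "{v. v < word_order I \<and> rank I v < k}"
  have fin: "finite S" "finite ?T"
    using assms(1) finite_subset by auto
  have "card S \<le> card ?T"
    using assms card_mono[OF _ assms(1)] by (simp add: card_rank_less)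
  then have "card (S - ?T) \<le> card (?T - S)"
    using fin card_Diff_subset_Int[of S ?T] card_Diff_subset_Int[of ?T S]
    by (simp add: Int_commute diff_le_mono)
  then obtain f where f: "f ` (S - ?T) \<subseteq> ?T - S" "inj_on f (S - ?T)"
    using card_le_inj[of "S - ?T" "?T - S"] fin by auto
  have "(\<Sum>v\<in>S - ?T. deg I v) \<le> (\<Sum>v\<in>S - ?T. deg I (f v))"
  proof (rule sum_mono)
    fix v
    assume v: "v \<in> S - ?T"
    then have "f v \<in> ?T"
      using f(1) by blast
    with v assms(1) show "deg I v \<le> deg I (f v)"
      by (intro deg_le_of_rank_less) auto
  qed
  also have "\<dots> = (\<Sum>v\<in>f ` (S - ?T). deg I v)"
    using f(2) by (simp add: sum.reindex)
  also have "\<dots> \<le> (\<Sum>v\<in>?T - S. deg I v)"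
    using f(1) fin by (intro sum_mono2) auto
  finally have "(\<Sum>v\<in>S - ?T. deg I v) + (\<Sum>v\<in>S \<inter> ?T. deg I v) \<le>
      (\<Sum>v\<in>?T - S. deg I v) + (\<Sum>v\<in>S \<inter> ?T. deg I v)"
    by simp
  moreover have "(\<Sum>v\<in>S. deg I v) = (\<Sum>v\<in>S - ?T. deg I v) + (\<Sum>v\<in>S \<inter> ?T. deg I v)"
    using sum.Int_Diff[OF fin(1), of "deg I" ?T] by simp
  moreover have "(\<Sum>v\<in>?T. deg I v) = (\<Sum>v\<in>?T - S. deg I v) + (\<Sum>v\<in>S \<inter> ?T. deg I v)"
    using sum.Int_Diff[OF fin(2), of "deg I" S] by (simp add: Int_commute)
  ultimately show ?thesis
    by linarith
qed

text \<open>With \<open>T\<close> the top set, \<open>covered S \<le> Z = \<alpha> Z - (\<alpha> -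
  1) Z \<le> \<alpha> (Z - b^2) \<le> \<alpha> * covered T\<close>. The middle step is
  \<open>\<alpha> b^2 \<le> (\<alpha> - 1) Z\<close>, which combines the choice of \<open>c\<close>
  with \<open>c b^2 \<le> Z\<close>.\<close>

lemma top_covers_most:
  fixes \<alpha> :: real
  assumes hub: "has_hub c I k" and S: "S \<subseteq> {..<word_order I}" "card S \<le> k"
    and \<alpha>: "\<alpha> > 1" "real c \<ge> \<alpha> / (\<alpha> - 1)"
  shows "covered (word_edges I) S \<le>
    \<alpha> * covered (word_edges I) {v. v < word_order I \<and> rank I v < k}"
proof -
  let ?T = "{v. v < word_order I \<and> rank I v < k}"
  define b where "b = budget I k"
  define Z where "Z = (\<Sum>v\<in>?T. deg I v)"
  have card: "card ?T = b"
    by (simp add: card_rank_less b_def budget_def)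
  have Z: "c * (b * b) \<le> Z"
  proof (cases "b = 0")
    case False
    obtain v where v: "v < word_order I" "threshold c I k < deg I v"
      using hub by (auto simp: has_hub_def)
    \<comment> \<open>As \<open>b\<close> is not 0, a single vertex is within the budget, so the
      degree of the hub alone bounds \<open>Z\<close> from below.\<close>
    have "(\<Sum>v\<in>{v}. deg I v) \<le> Z"
      unfolding Z_def using v(1) False by (intro sum_deg_le_top) (auto simp: b_def budget_def)
    with v(2) show ?thesis
      by (simp add: threshold_def b_def algebra_simps)
  qed simp
  have "covered (word_edges I) S \<le> Z"
    using covered_le_sum_deg[OF S(1)] sum_deg_le_top[OF S] unfolding Z_def by (rule le_trans)
  then have "real (covered (word_edges I) S) \<le> real Z"
    by simp
  moreover have "Z \<le> covered (word_edges I) ?T + b * b"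
    unfolding Z_def using sum_deg_le_covered[of ?T I] card by auto
  then have "real Z \<le> real (covered (word_edges I) ?T) + real (b * b)"
    by (metis of_nat_add of_nat_mono)
  then have "\<alpha> * real Z \<le> \<alpha> * (real (covered (word_edges I) ?T) + real (b * b))"
    using \<alpha>(1) by (intro mult_left_mono) auto
  moreover have "\<alpha> * real (b * b) \<le> (\<alpha> - 1) * real Z"
  proof -
    have "\<alpha> \<le> (\<alpha> - 1) * real c"
      using \<alpha> by (simp add: field_simps)
    then have "\<alpha> * real (b * b) \<le> (\<alpha> - 1) * real c * real (b * b)"
      by (rule mult_right_mono) simp
    also have "\<dots> = (\<alpha> - 1) * real (c * (b * b))"
      by simp
    also have "\<dots> \<le> (\<alpha> - 1) * real Z"
      using \<alpha>(1) Z by (intro mult_left_mono of_nat_mono) auto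
    finally show ?thesis .
  qed
  ultimately show ?thesis
    by (simp add: algebra_simps)
qed

section \<open>Solutions inside the core when there is no hub\<close>

lemma deg_le_threshold: "\<not> has_hub c I k \<Longrightarrow> v < word_order I \<Longrightarrow> deg I v \<le> threshold c I k"
  unfolding has_hub_def by (meson not_le)

lemma core_subset: "core c I k \<subseteq> {..<word_order I}"
  by (auto simp: core_def)

lemma finite_core [simp]: "finite (core c I k)"
  using finite_subset[OF core_subset] by blast

lemma core_subset_kept: "core c I k \<subseteq> kept c I k"
  by (auto simp: kept_def core_def)

text \<open>Each exchange brings one more solution vertex into the core without lowering the
  coverage, so the induction is on the number of solution vertices outside.\<close>

lemma ex_solution_in_core:
  assumes "\<not> has_hub c I k" "S \<subseteq> {..<word_order I}" "card S \<le> k"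
  shows "\<exists>S'\<subseteq>core c I k. card S' \<le> k \<and> covered (word_edges I) S \<le> covered (word_edges I) S'"
  using assms(2,3)
proof (induction "card (S - core c I k)" arbitrary: S rule: less_induct)
  case less
  define n where "n = word_order I"
  define D where "D = threshold c I k"
  define b where "b = budget I k"
  define C where "C = core c I k"
  note S = less.prems[folded n_def]
  have "finite S"
    using S(1) finite_subset by blast
  show ?case
  proof (cases "S \<subseteq> C")
    case False
    then obtain v where v: "v \<in> S" "v \<notin> C"
      by blast
    define R where "R = S - {v}"
    have R: "finite R" "R \<subseteq> {..<n}" "S = insert v R" "v \<notin> R" "card S = Suc (card R)"
      using v(1) S(1) \<open>finite S\<close> card.remove[of S v] by (auto simp: R_def)
    have "v < n"
      using v S by auto
    have C: "C = {v. v < n \<and> rank I v < b * (D + 1)}"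
      using assms(1) by (simp add: C_def core_def n_def b_def D_def)
    \<comment> \<open>A vertex outside the core has rank at least \<open>b * (D + 1)\<close>, so the
      graph has more vertices than that and the core reaches its full size.\<close>
    have "rank I v < n"
      using bij_betw_rank[of I] \<open>v < n\<close> by (auto simp: bij_betw_def n_def)
    then have cardC: "card C = b * (D + 1)"
      using \<open>v < n\<close> v(2) card_rank_less[of I "b * (D + 1)"] by (simp add: C n_def)
    have "card S \<le> b"
      using S card_mono[OF _ S(1)] by (simp add: b_def budget_def n_def)
    \<comment> \<open>The blocked vertices: the closed neighbourhood of the rest \<open>R\<close> of
      the solution. As \<open>R\<close> has fewer than \<open>b\<close> elements, it cannot exhaust
      the core.\<close>
    define B where "B = (\<Union>x\<in>R. insert x {u. u < n \<and> adj I x u})"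
    have "card B \<le> (\<Sum>x\<in>R. card (insert x {u. u < n \<and> adj I x u}))"
      unfolding B_def using R(1) by (rule card_UN_le)
    also have "\<dots> \<le> (\<Sum>x\<in>R. D + 1)"
    proof (rule sum_mono)
      fix x
      assume "x \<in> R"
      then have "x < n"
        using R(2) by auto
      then have "deg I x \<le> D"
        using deg_le_threshold[OF assms(1)] by (simp add: n_def D_def)
      then have "card {u. u < n \<and> adj I x u} + 1 \<le> D + 1"
        by (simp add: deg_def n_def)
      then show "card (insert x {u. u < n \<and> adj I x u}) \<le> D + 1"
        by (auto simp: card_insert_if)
    qed
    also have "\<dots> = card R * (D + 1)"
      by simp
    also have "\<dots> < b * (D + 1)"
      using R(5) \<open>card S \<le> b\<close> by (intro mult_strict_right_mono) auto
    finally have "card B < card C"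
      by (simp add: cardC)
    moreover have "finite B"
      using R(1) by (simp add: B_def)
    ultimately obtain u where u: "u \<in> C" "u \<notin> B"
      by (meson card_mono not_le subsetI)
    have u': "u < n" "u \<notin> R" "u \<notin> S"
      using u v(2) R(3) by (auto simp: C B_def)
    \<comment> \<open>No neighbour of \<open>u\<close> lies in \<open>R\<close>, so \<open>u\<close>
      contributes its whole degree, whereas \<open>v\<close> contributed at most its own.\<close>
    have "{w. w < n \<and> adj I u w \<and> w \<notin> R} = {w. w < n \<and> adj I u w}"
      using u(2) u'(1) by (auto simp: B_def adj_sym)
    then have "covered (word_edges I) (insert u R) = covered (word_edges I) R + deg I u"
      using u' by (simp add: covered_insert n_def deg_def)
    moreover have "deg I v \<le> deg I u"
      using u(1) v(2) u'(1) \<open>v < n\<close> by (intro deg_le_of_rank_less) (auto simp: C n_def)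
    moreover have "covered (word_edges I) S \<le> covered (word_edges I) R + deg I v"
      using covered_insert_le \<open>v < n\<close> unfolding R(3) n_def by blast
    ultimately have le: "covered (word_edges I) S \<le> covered (word_edges I) (insert u R)"
      by linarith
    have "insert u R - C \<subset> S - C"
      using u(1) v R(3,4) by auto
    then have "card (insert u R - C) < card (S - C)"
      using \<open>finite S\<close> by (intro psubset_card_mono) auto
    moreover have "insert u R \<subseteq> {..<n}" "card (insert u R) \<le> k"
      using u' R S by (auto simp: card_insert_if)
    ultimately obtain S' where "S' \<subseteq> C" "card S' \<le> k"
        "covered (word_edges I) (insert u R) \<le> covered (word_edges I) S'"
      using less.hyps[of "insert u R"] unfolding C_def n_def by blast
    with le show ?thesis
      unfolding C_def by (meson le_trans)
  qed (use S in \<open>auto simp: C_def\<close>)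
qed

text \<open>Each of the at most \<open>b * (D + 1)\<close> core vertices brings in at most
  \<open>D\<close> neighbours; with a hub there is nothing to count.\<close>

lemma card_kept_bound:
  "card (kept c I k) \<le> budget I k * (threshold c I k + 1) * (threshold c I k + 1)"
proof (cases "has_hub c I k")
  case False
  define D where "D = threshold c I k"
  have "kept c I k \<subseteq> (\<Union>u\<in>core c I k. insert u {v. v < word_order I \<and> adj I u v})"
    by (auto simp: kept_def)
  then have "card (kept c I k) \<le> card (\<Union>u\<in>core c I k. insert u {v. v < word_order I \<and> adj I u v})"
    by (intro card_mono) auto
  also have "\<dots> \<le> (\<Sum>u\<in>core c I k. card (insert u {v. v < word_order I \<and> adj I u v}))"
    by (rule card_UN_le) simp
  also have "\<dots> \<le> (\<Sum>u\<in>core c I k. D + 1)"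
  proof (rule sum_mono)
    fix u
    assume "u \<in> core c I k"
    then have "deg I u \<le> D"
      using deg_le_threshold[OF False] core_subset[of c I k] by (auto simp: D_def)
    then show "card (insert u {v. v < word_order I \<and> adj I u v}) \<le> D + 1"
      by (auto simp: deg_def card_insert_if)
  qed
  also have "\<dots> = card (core c I k) * (D + 1)"
    by simp
  also have "\<dots> \<le> budget I k * (D + 1) * (D + 1)"
    using False card_rank_less[of I "budget I k * (D + 1)"]
    by (intro mult_le_mono1) (simp add: core_def D_def)
  finally show ?thesis
    by (simp add: D_def)
qed (simp add: kept_def core_def)

section \<open>The reduced word as an induced subgraph\<close>

lemma length_reduced: "length (reduced c I k) = card (kept c I k) * card (kept c I k)"
  by (simp add: reduced_def Let_def)

lemma word_order_reduced: "word_order (reduced c I k) = card (kept c I k)"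
  by (simp add: word_order_def length_reduced flip: power2_eq_square)

lemma adj_reduced:
  assumes "u \<in> kept c I k" "v \<in> kept c I k"
  shows "adj (reduced c I k) (position (kept c I k) u) (position (kept c I k) v) \<longleftrightarrow> adj I u v"
proof -
  define K where "K = kept c I k"
  define p where "p = position K"
  have bij: "bij_betw p K {..<card K}"
    unfolding p_def K_def by (rule bij_betw_position) simp
  have inv: "inv_into K p (p w) = w" if "w \<in> K" for w
    using that bij by (simp add: bij_betw_def)
  have less: "p w < card K" if "w \<in> K" for w
    using that bij by (auto simp: bij_betw_def)
  have nth: "reduced c I k ! (p x * card K + p y) \<longleftrightarrow> adj I x y" if "x \<in> K" "y \<in> K" for x y
  proof -
    have "p x * card K + p y < card K * card K" "(p x * card K + p y) div card K = p x"
      "(p x * card K + p y) mod card K = p y"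
      using less[OF that(1)] less[OF that(2)] matrix_index_less by auto
    then show ?thesis
      using that inv by (simp add: reduced_def Let_def flip: K_def p_def)
  qed
  have "u \<noteq> v \<longleftrightarrow> p u \<noteq> p v"
    using assms bij unfolding K_def[symmetric] bij_betw_def by (metis inj_on_eq_iff)
  moreover have "u \<noteq> v" if "adj I u v"
    using that by (simp add: adj_def)
  ultimately show ?thesis
    using assms nth[of u v] nth[of v u] adj_sym[of I v u]
    unfolding adj_def[of "reduced c I k"] word_order_reduced K_def[symmetric] p_def[symmetric]
    by blast
qed

lemma word_edges_reduced:
  "word_edges (reduced c I k) =
    (`) (position (kept c I k)) ` {e \<in> word_edges I. e \<subseteq> kept c I k}"
proof -
  define K where "K = kept c I k"
  define p where "p = position K"
  have bij: "p ` K = {..<card K}"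
    using bij_betw_position[of K] by (simp add: p_def K_def bij_betw_def)
  have adj: "adj (reduced c I k) (p u) (p v) \<longleftrightarrow> adj I u v" if "u \<in> K" "v \<in> K" for u v
    using that unfolding p_def K_def by (rule adj_reduced)
  have K: "u < word_order I" if "u \<in> K" for u
    using that kept_subset unfolding K_def by blast
  have "e \<in> word_edges (reduced c I k) \<longleftrightarrow> e \<in> (`) p ` {e \<in> word_edges I. e \<subseteq> K}" for e
  proof
    assume "e \<in> word_edges (reduced c I k)"
    then obtain i j where e: "e = {i, j}" "i \<in> p ` K" "j \<in> p ` K" "adj (reduced c I k) i j"
      unfolding word_edges_iff word_order_reduced K_def[symmetric] bij by auto
    then obtain u v where uv: "u \<in> K" "v \<in> K" "i = p u" "j = p v"
      by auto
    then have "{u, v} \<in> word_edges I"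
      using e(4) adj K by (simp add: pair_in_word_edges)
    with uv e(1) show "e \<in> (`) p ` {e \<in> word_edges I. e \<subseteq> K}"
      by (intro image_eqI[of _ _ "{u, v}"]) auto
  next
    assume "e \<in> (`) p ` {e \<in> word_edges I. e \<subseteq> K}"
    then obtain u v where uv: "e = {p u, p v}" "u \<in> K" "v \<in> K" "adj I u v"
      by (auto simp: word_edges_iff)
    then show "e \<in> word_edges (reduced c I k)"
      using adj bij by (auto simp: pair_in_word_edges word_order_reduced simp flip: K_def)
  qed
  then show ?thesis
    unfolding p_def K_def by blast
qed

text \<open>The renumbering is injective on the kept set, so it preserves whether an edge inside the
  kept set meets \<open>S\<close>. Only edges that leave the kept set are lost.\<close>

lemma covered_reduced:
  assumes "S \<subseteq> kept c I k"
  shows "covered (word_edges (reduced c I k)) (position (kept c I k) ` S) =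
    card {e \<in> word_edges I. e \<subseteq> kept c I k \<and> e \<inter> S \<noteq> {}}"
proof -
  define K where "K = kept c I k"
  define p where "p = position K"
  have inj: "inj_on p K"
    using bij_betw_position[of K] by (simp add: p_def K_def bij_betw_def)
  have "p ` e \<inter> p ` S \<noteq> {} \<longleftrightarrow> e \<inter> S \<noteq> {}" if "e \<subseteq> K" for e
    using inj_on_image_Int[OF inj that] assms by (metis K_def image_is_empty)
  then have "{e \<in> word_edges I. e \<subseteq> K \<and> p ` e \<inter> p ` S \<noteq> {}} =
      {e \<in> word_edges I. e \<subseteq> K \<and> e \<inter> S \<noteq> {}}"
    by metis
  moreover have "{y \<in> h ` {e \<in> A. P e}. Q y} = h ` {e \<in> A. P e \<and> Q (h e)}"
    for h :: "nat set \<Rightarrow> nat set" and A P Q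
    by auto
  ultimately have "{e \<in> (`) p ` {e \<in> word_edges I. e \<subseteq> K}. e \<inter> p ` S \<noteq> {}} =
      (`) p ` {e \<in> word_edges I. e \<subseteq> K \<and> e \<inter> S \<noteq> {}}"
    by simp
  moreover have "inj_on ((`) p) {e \<in> word_edges I. e \<subseteq> K \<and> e \<inter> S \<noteq> {}}"
    by (rule inj_on_subset[OF inj_on_image_Pow[OF inj]]) auto
  ultimately show ?thesis
    unfolding covered_def word_edges_reduced K_def[symmetric] p_def[symmetric]
    by (simp add: card_image)
qed

lemma covered_reduced_le:
  assumes "S \<subseteq> kept c I k"
  shows "covered (word_edges (reduced c I k)) (position (kept c I k) ` S) \<le> covered (word_edges I) S"
  by (simp only: covered_reduced[OF assms], unfold covered_def, intro card_mono) auto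

text \<open>An edge that meets the core has its other end among the neighbours of the core, hence
  lies inside the kept set. This is why neighbours are kept.\<close>

lemma covered_reduced_core:
  assumes "S \<subseteq> core c I k"
  shows "covered (word_edges (reduced c I k)) (position (kept c I k) ` S) = covered (word_edges I) S"
proof -
  have "e \<subseteq> kept c I k" if e: "e \<in> word_edges I" "e \<inter> S \<noteq> {}" for e
  proof -
    obtain u v where uv: "e = {u, v}" "u < word_order I" "v < word_order I" "adj I u v"
      using e(1) unfolding word_edges_iff by blast
    moreover from uv(1) e(2) have "u \<in> S \<or> v \<in> S"
      by auto
    ultimately have "u \<in> kept c I k" "v \<in> kept c I k"
      using assms adj_sym[of I u v] unfolding kept_def by blast+
    then show ?thesis
      using uv(1) by simp
  qed
  then have "{e \<in> word_edges I. e \<subseteq> kept c I k \<and> e \<inter> S \<noteq> {}} = {e \<in> word_edges I. e \<inter> S \<noteq> {}}"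
    by blast
  then show ?thesis
    using covered_reduced[of S c I k] assms core_subset_kept by (simp add: covered_def subset_trans)
qed

section \<open>Optima and ratios\<close>

lemma word_vertex_set_subset: "word_vertex_set I s \<subseteq> {..<word_order I}"
  by (auto simp: word_vertex_set_def)

lemma PVC_eq:
  "PVC I k s = (if card (word_vertex_set I s) > k then - \<infinity>
    else ereal (real (covered (word_edges I) (word_vertex_set I s))))"
  by (simp add: PVC_def pvc_value_def covered_def)

lemma finite_solutions: "finite (solutions I k)"
  using finite_lists_length_le[of "UNIV :: bool set" "length I + k"] by (simp add: solutions_def)

lemma PVC_le_OPT: "s \<in> solutions I k \<Longrightarrow> PVC I k s \<le> OPT PVC I k"
  unfolding OPT_def using finite_solutions by (intro Max_ge) auto

lemma covered_le_OPT:
  assumes "S \<subseteq> {..<word_order I}" "card S \<le> k"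
  shows "ereal (real (covered (word_edges I) S)) \<le> OPT PVC I k"
proof -
  define w where "w = map (\<lambda>v. v \<in> S) [0..<word_order I]"
  have "word_vertex_set I w = S"
    using assms(1) by (auto simp: word_vertex_set_def w_def)
  moreover have "w \<in> solutions I k"
    using word_order_le[of I] by (simp add: solutions_def w_def)
  ultimately show ?thesis
    using PVC_le_OPT[of w I k] assms(2) by (simp add: PVC_eq)
qed

lemma OPT_attained:
  obtains S where "S \<subseteq> {..<word_order I}" "card S \<le> k"
    "OPT PVC I k = ereal (real (covered (word_edges I) S))"
proof -
  have "OPT PVC I k \<in> PVC I k ` solutions I k"
    unfolding OPT_def using finite_solutions by (intro Max_in) (auto simp: solutions_def intro: exI[of _ "[]"])
  then obtain s where s: "OPT PVC I k = PVC I k s"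
    by blast
  \<comment> \<open>The empty vertex set is always within the budget. So the optimum is not
    \<open>-\<infinity>\<close>, and a word that attains it respects the budget.\<close>
  have "0 \<le> OPT PVC I k"
    using covered_le_OPT[of "{}" I k] by (simp add: covered_def zero_ereal_def)
  with s have "card (word_vertex_set I s) \<le> k"
    by (auto simp: PVC_eq split: if_splits)
  with s word_vertex_set_subset show thesis
    by (intro that[of "word_vertex_set I s"]) (auto simp: PVC_eq)
qed

text \<open>Confines extended real arithmetic to one place: a ratio is either
  \<open>-\<infinity>\<close>, for a set beyond the budget, or a real fraction. The fraction is only
  formed for \<open>x < m\<close>, so its denominator is positive.\<close>

lemma ratio_cases:
  assumes "s \<in> solutions I k"
  obtains "ratio PVC I k s = - \<infinity>" "card (word_vertex_set I s) > k"
  | x m where "PVC I k s = ereal x" "OPT PVC I k = ereal m" "0 \<le> x" "x \<le> m"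
      "ratio PVC I k s = ereal (if x = m then 1 else x / m)"
proof -
  obtain S where S: "OPT PVC I k = ereal (real (covered (word_edges I) S))"
    using OPT_attained by blast
  show thesis
  proof (cases "card (word_vertex_set I s) > k")
    case True
    \<comment> \<open>This includes \<open>m = 0\<close>, since the inverse of 0 is
      \<open>\<infinity>\<close> in the extended reals.\<close>
    have "- \<infinity> / ereal (real m) = - \<infinity>" for m
      by (cases "m = 0") (simp_all add: divide_ereal_def)
    with True show thesis
      using S by (intro that(1)) (simp_all add: ratio_def PVC_eq)
  next
    case False
    then have v: "PVC I k s = ereal (real (covered (word_edges I) (word_vertex_set I s)))"
      by (simp add: PVC_eq)
    show thesis
      using PVC_le_OPT[OF assms] v S
      by (intro that(2)[OF v S]) (auto simp: ratio_def)
  qed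
qed

text \<open>A larger numerator over a smaller denominator. The convention for optimal solutions does
  no harm: \<open>x' = m'\<close> forces \<open>x = m\<close> by
  \<open>m \<le> m' = x' \<le> x \<le> m\<close>.\<close>

lemma ratio_ge_of_PVC_ge:
  assumes "s' \<in> solutions I' k'" "s \<in> solutions I k"
    and "PVC I' k' s' \<le> PVC I k s" "OPT PVC I k \<le> OPT PVC I' k'"
  shows "ratio PVC I' k' s' \<le> ratio PVC I k s"
proof (rule ratio_cases[OF assms(1)])
  fix x' m'
  assume *: "PVC I' k' s' = ereal x'" "OPT PVC I' k' = ereal m'" "0 \<le> x'" "x' \<le> m'"
    "ratio PVC I' k' s' = ereal (if x' = m' then 1 else x' / m')"
  show ?thesis
  proof (rule ratio_cases[OF assms(2)])
    assume "card (word_vertex_set I s) > k"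
    then show ?thesis
      using assms(3) * by (simp add: PVC_eq)
  next
    fix x m
    assume "PVC I k s = ereal x" "OPT PVC I k = ereal m" "0 \<le> x" "x \<le> m"
      "ratio PVC I k s = ereal (if x = m then 1 else x / m)"
    moreover from this * assms(3,4) have "x' \<le> x" "m \<le> m'"
      by simp_all
    ultimately show ?thesis
      using * frac_le[of x x' m m'] by auto
  qed
qed simp

section \<open>Ratios of lifted solutions\<close>

lemma lifted_in_solutions: "lifted c I k s' \<in> solutions I k"
  using word_order_le[of I] by (simp add: solutions_def lifted_def)

text \<open>With a hub the kept set is empty, so every \<open>s'\<close> is lifted to the same set,
  the first \<open>k\<close> vertices in the degree order, and \<open>top_covers_most\<close>
  applies.\<close>

lemma ratio_lifted_hub:
  fixes \<alpha> :: real
  assumes "has_hub c I k" "\<alpha> > 1" "real c \<ge> \<alpha> / (\<alpha> - 1)"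
  shows "ereal (1 / \<alpha>) \<le> ratio PVC I k (lifted c I k s')"
proof -
  have "kept c I k = {}"
    using assms(1) by (simp add: kept_def core_def)
  then have T: "word_vertex_set I (lifted c I k s') = {v. v < word_order I \<and> rank I v < k}"
    using assms(1) by (auto simp: word_vertex_set_def lifted_def)
  show ?thesis
  proof (rule ratio_cases[OF lifted_in_solutions])
    assume "card (word_vertex_set I (lifted c I k s')) > k"
    then show ?thesis
      by (simp add: T card_rank_less)
  next
    fix x m
    assume *: "PVC I k (lifted c I k s') = ereal x" "OPT PVC I k = ereal m" "0 \<le> x" "x \<le> m"
      "ratio PVC I k (lifted c I k s') = ereal (if x = m then 1 else x / m)"
    obtain S where S: "S \<subseteq> {..<word_order I}" "card S \<le> k"
        "OPT PVC I k = ereal (real (covered (word_edges I) S))"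
      by (rule OPT_attained)
    have "m \<le> \<alpha> * x"
      using top_covers_most[OF assms(1) S(1,2) assms(2,3)] * S(3)
      by (simp add: PVC_eq T card_rank_less)
    then show ?thesis
      using * assms(2) by (simp add: divide_simps mult.commute)
  qed
qed

text \<open>Lifting back can only regain edges that leave the kept set, and some optimal solution
  lies in the core and keeps its value in the reduced graph. So the value does not drop and the
  optimum of the input is not larger.\<close>

lemma ratio_lifted_no_hub:
  assumes hub: "\<not> has_hub c I k" and s': "s' \<in> solutions (reduced c I k) k"
  shows "ratio PVC (reduced c I k) k s' \<le> ratio PVC I k (lifted c I k s')"
proof -
  define K where "K = kept c I k"
  define p where "p = position K"
  have bij: "bij_betw p K {..<card K}"
    unfolding p_def K_def by (rule bij_betw_position) simp
  define S where "S = word_vertex_set I (lifted c I k s')"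
  have S: "S = {v \<in> K. p v < length s' \<and> s' ! p v}"
    using hub kept_subset[of c I k]
    by (auto simp: S_def word_vertex_set_def lifted_def K_def p_def)
  have pS: "p ` S = word_vertex_set (reduced c I k) s'"
  proof -
    have "p ` S = {i \<in> p ` K. i < length s' \<and> s' ! i}"
      unfolding S by blast
    then show ?thesis
      using bij by (simp add: bij_betw_def word_vertex_set_def word_order_reduced K_def)
  qed
  have card: "card (p ` S) = card S"
    using bij S by (intro card_image) (auto simp: bij_betw_def inj_on_def)
  have "S \<subseteq> kept c I k"
    using S by (auto simp: K_def)
  then have "covered (word_edges (reduced c I k)) (p ` S) \<le> covered (word_edges I) S"
    unfolding p_def K_def by (rule covered_reduced_le)
  then have val_le: "PVC (reduced c I k) k s' \<le> PVC I k (lifted c I k s')"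
    unfolding PVC_eq S_def[symmetric] pS[symmetric] using card by simp
  obtain S0 where S0: "S0 \<subseteq> {..<word_order I}" "card S0 \<le> k"
      "OPT PVC I k = ereal (real (covered (word_edges I) S0))"
    by (rule OPT_attained)
  obtain S1 where S1: "S1 \<subseteq> core c I k" "card S1 \<le> k"
      "covered (word_edges I) S0 \<le> covered (word_edges I) S1"
    using ex_solution_in_core[OF hub S0(1,2)] by blast
  have "S1 \<subseteq> K"
    using S1(1) core_subset_kept unfolding K_def by blast
  then have "card (p ` S1) = card S1"
    using bij by (intro card_image) (auto simp: bij_betw_def inj_on_def)
  moreover have "p ` S1 \<subseteq> {..<word_order (reduced c I k)}"
    unfolding word_order_reduced K_def[symmetric] using \<open>S1 \<subseteq> K\<close> bij by (auto simp: bij_betw_def)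
  ultimately have "ereal (real (covered (word_edges (reduced c I k)) (p ` S1))) \<le> OPT PVC (reduced c I k) k"
    using S1(2) by (intro covered_le_OPT) auto
  moreover have "covered (word_edges (reduced c I k)) (p ` S1) = covered (word_edges I) S1"
    using S1(1) unfolding p_def K_def by (rule covered_reduced_core)
  ultimately have "OPT PVC I k \<le> OPT PVC (reduced c I k) k"
    using S0(3) S1(3) by (metis ereal_less_eq(3) of_nat_mono order_trans)
  with val_le show ?thesis
    using s' lifted_in_solutions by (intro ratio_ge_of_PVC_ge)
qed

text \<open>For positive \<open>k\<close> the threshold plus 1 is at most
  \<open>(c + 1) k^2\<close>, so at most \<open>(c + 1)^2 k^5\<close> vertices are kept, and the
  matrix squares this; the summand 1 pays for the parameter. For \<open>k = 0\<close> the bound is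
  0, which is met because nothing is kept.\<close>

lemma length_reduced_bound:
  "length (reduced c I k) + k \<le> ((c + 1) ^ 4 + 1) * k ^ 10"
proof (cases "k = 0")
  case True
  then have "card (kept c I k) = 0"
    using card_kept_bound[of c I k] by (simp add: budget_def)
  then show ?thesis
    using True by (simp add: length_reduced)
next
  case False
  define a where "a = c + 1"
  have "budget I k \<le> k"
    by (simp add: budget_def)
  then have "threshold c I k + 1 \<le> k * (k * c) + 1"
    unfolding threshold_def by (intro add_mono mult_le_mono) auto
  also have "\<dots> \<le> a * (k * k)"
    using False by (simp add: a_def algebra_simps)
  finally have "threshold c I k + 1 \<le> a * (k * k)" .
  then have "budget I k * (threshold c I k + 1) * (threshold c I k + 1) \<le>
      k * (a * (k * k)) * (a * (k * k))"
    using \<open>budget I k \<le> k\<close> by (intro mult_le_mono)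
  then have "card (kept c I k) \<le> k * (a * (k * k)) * (a * (k * k))"
    using card_kept_bound le_trans by blast
  then have "length (reduced c I k) \<le> (k * (a * (k * k)) * (a * (k * k))) * (k * (a * (k * k)) * (a * (k * k)))"
    unfolding length_reduced by (intro mult_le_mono)
  also have "\<dots> = a ^ 4 * k ^ 10"
    by (simp add: eval_nat_numeral mult_ac)
  finally have "length (reduced c I k) \<le> a ^ 4 * k ^ 10" .
  moreover have "k \<le> k ^ 10"
    using False by (simp add: self_le_power)
  ultimately show ?thesis
    unfolding a_def[symmetric] by (simp add: add_mult_distrib)
qed

section \<open>Running times and determinism of the preprocessing\<close>

definition pvc_preprocessing :: "nat \<Rightarrow> preprocessing" where
  "pvc_preprocessing c = (reduction c, lifting c)"

text \<open>The output length is charged to the running time, which must be bounded without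
  \<open>k\<close>; hence this bound by the input in addition to the one by the parameter.\<close>

lemma length_reduced_le: "length (reduced c I k) \<le> length I"
  using mult_le_mono[OF card_kept_le card_kept_le] word_order_square_le
  unfolding length_reduced by (rule le_trans)

lemma length_le_square: "length I \<le> (length I + 1)\<^sup>2"
  by (simp add: power2_eq_square)

lemma reduces_exists:
  "\<exists>t \<le> 2001 * (length I + 1)\<^sup>2. reduces (pvc_preprocessing c) I k t (reduced c I k) k"
proof -
  let ?\<sigma> = "zero_store(0 := word_array I, 1 := num_array k)"
  have "runs (reduction c) ?\<sigma> (2000 * (length I + 1)\<^sup>2)
      (\<lambda>\<tau>. array_word (\<tau> 0) = reduced c I k \<and> \<tau> 1 0 = k)"
    by (rule runs_reduction) (auto simp: num_array_def zero_store_def)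
  then obtain t \<tau> where *: "exec (reduction c) ?\<sigma> t \<tau>" "t \<le> 2000 * (length I + 1)\<^sup>2"
      "array_word (\<tau> 0) = reduced c I k" "\<tau> 1 0 = k"
    by (auto simp: runs_def)
  have "t + length (reduced c I k) \<le> 2001 * (length I + 1)\<^sup>2"
    using *(2) length_reduced_le[of c I k] length_le_square[of I] by linarith
  moreover have "reduces (pvc_preprocessing c) I k (t + length (reduced c I k)) (reduced c I k) k"
    unfolding reduces_def pvc_preprocessing_def using * by force
  ultimately show ?thesis
    by blast
qed

lemma lifts_exists:
  "\<exists>t \<le> 2001 * (length I + 1)\<^sup>2. lifts (pvc_preprocessing c) I k I' k' s' t (lifted c I k s')"
proof -
  let ?\<sigma> = "zero_store(0 := word_array I, 1 := num_array k, 2 := word_array I',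
    3 := num_array k', 4 := word_array s')"
  have "runs (lifting c) ?\<sigma> (2000 * (length I + 1)\<^sup>2) (\<lambda>\<tau>. array_word (\<tau> 0) = lifted c I k s')"
    by (rule runs_lifting) (auto simp: num_array_def zero_store_def)
  then obtain t \<tau> where *: "exec (lifting c) ?\<sigma> t \<tau>" "t \<le> 2000 * (length I + 1)\<^sup>2"
      "array_word (\<tau> 0) = lifted c I k s'"
    by (auto simp: runs_def)
  have "length (lifted c I k s') \<le> length I"
    using word_order_le by (simp add: lifted_def)
  then have "t + length (lifted c I k s') \<le> 2001 * (length I + 1)\<^sup>2"
    using *(2) length_le_square[of I] by linarith
  moreover have "lifts (pvc_preprocessing c) I k I' k' s' (t + length (lifted c I k s')) (lifted c I k s')"
    unfolding lifts_def pvc_preprocessing_def using * by force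
  ultimately show ?thesis
    by blast
qed

text \<open>Strictness and the size and time bounds quantify over all runs. Determinism transfers to
  them what is known of the one run constructed before.\<close>

lemma reduces_deterministic:
  "reduces P I k t I' k' \<Longrightarrow> reduces P I k u J l \<Longrightarrow> t = u \<and> I' = J \<and> k' = l"
  unfolding reduces_def using exec_deterministic by blast

lemma lifts_deterministic:
  "lifts P I k I' k' s' t s \<Longrightarrow> lifts P I k I' k' s' u r \<Longrightarrow> t = u \<and> s = r"
  unfolding lifts_def using exec_deterministic by blast

lemma reducesD:
  assumes "reduces (pvc_preprocessing c) I k t I' k'"
  shows "I' = reduced c I k" "k' = k" "t \<le> 2001 * (length I + 1)\<^sup>2"
  using assms reduces_exists[of I c k] reduces_deterministic by blast+

lemma liftsD:
  assumes "lifts (pvc_preprocessing c) I k I' k' s' t s"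
  shows "s = lifted c I k s'" "t \<le> 2001 * (length I + 1)\<^sup>2"
  using assms lifts_exists[of I c k I' k' s'] lifts_deterministic by blast+

lemma ratio_lifted:
  fixes \<alpha> :: real
  assumes "\<alpha> > 1" "real c \<ge> \<alpha> / (\<alpha> - 1)" "s' \<in> solutions (reduced c I k) k"
  shows "min (ratio PVC (reduced c I k) k s') (ereal (1 / \<alpha>)) \<le> ratio PVC I k (lifted c I k s')"
  using ratio_lifted_hub[of c I k \<alpha> s'] ratio_lifted_no_hub[of c I k s'] assms
  by (cases "has_hub c I k") (auto simp: min_le_iff_disj)

text \<open>Ratios never exceed 1. If the lifted ratio \<open>r\<close> is at least
  \<open>1 / \<alpha>\<close>, then \<open>\<alpha> r \<ge> 1\<close>; otherwise \<open>r\<close> is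
  at least the given ratio, and multiplying a nonnegative number by \<alpha> does not decrease
  it.\<close>

lemma approx_of_strict:
  fixes \<alpha> :: real
  assumes "\<alpha> > 1" "s' \<in> solutions I' k'" "s \<in> solutions I k"
    and "min (ratio PVC I' k' s') (ereal (1 / \<alpha>)) \<le> ratio PVC I k s"
  shows "ratio PVC I' k' s' \<le> ereal \<alpha> * ratio PVC I k s"
proof (rule ratio_cases[OF assms(2)])
  fix x' m'
  assume *: "0 \<le> x'" "x' \<le> m'" "ratio PVC I' k' s' = ereal (if x' = m' then 1 else x' / m')"
  define r' where "r' = (if x' = m' then 1 else x' / m')"
  have r': "ratio PVC I' k' s' = ereal r'" "0 \<le> r'" "r' \<le> 1"
    using * by (auto simp: r'_def divide_simps)
  obtain r where r: "ratio PVC I k s = ereal r"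
  proof (rule ratio_cases[OF assms(3)])
    \<comment> \<open>Impossible, as both arguments of the minimum are real here.\<close>
    assume "ratio PVC I k s = - \<infinity>"
    then show thesis
      using assms(4) r' by (simp add: min_def split: if_splits)
  qed
  have "r' \<le> r \<or> 1 / \<alpha> \<le> r"
    using assms(4) r r' by (auto simp: min_le_iff_disj)
  then have "r' \<le> \<alpha> * r"
  proof
    assume "r' \<le> r"
    then show ?thesis
      using r'(2) assms(1) mult_right_mono[of 1 \<alpha> r] by simp
  next
    assume "1 / \<alpha> \<le> r"
    then have "1 \<le> \<alpha> * r"
      using assms(1) by (simp add: divide_simps mult.commute)
    then show ?thesis
      using r'(3) by simp
  qed
  then show ?thesis
    by (simp add: r r')
qed simp

theorem theorem6p1:
  shows "\<exists>A. strict_PSAKS PVC A \<and> size_efficient A \<and> time_efficient A"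
proof -
  \<comment> \<open>The least natural number that \<open>top_covers_most\<close> admits, and the
    only way in which \<alpha> enters the programs.\<close>
  define c where "c \<alpha> = nat \<lceil>\<alpha> / (\<alpha> - 1)\<rceil>" for \<alpha> :: real
  have c: "real (c \<alpha>) \<ge> \<alpha> / (\<alpha> - 1)" for \<alpha>
    unfolding c_def by linarith
  define A where "A \<alpha> = pvc_preprocessing (c \<alpha>)" for \<alpha>
  have strict: "strict_preprocessing \<alpha> PVC (A \<alpha>)" if "\<alpha> > 1" for \<alpha>
    unfolding strict_preprocessing_def A_def
  proof (intro allI impI ballI)
    fix I k t I' k' s' t' s
    assume r: "reduces (pvc_preprocessing (c \<alpha>)) I k t I' k'" and s': "s' \<in> solutions I' k'"
      and l: "lifts (pvc_preprocessing (c \<alpha>)) I k I' k' s' t' s"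
    show "min (ratio PVC I' k' s') (ereal (1 / \<alpha>)) \<le> ratio PVC I k s"
      using s' unfolding reducesD(1,2)[OF r] liftsD(1)[OF l] by (rule ratio_lifted[OF that c])
  qed
  have approx: "approx_preprocessing \<alpha> PVC (A \<alpha>)" if "\<alpha> > 1" for \<alpha>
    unfolding approx_preprocessing_def
  \<comment> \<open>The polynomial \<open>2001 (X + 1)^2\<close>: 2000 for the run and 1 for the
    length of the output.\<close>
  proof (intro exI[of _ "Polynomial.smult 2001 ([:1, 1:] ^ 2)"] allI)
    fix I :: "bool list" and k
    have "poly (Polynomial.smult 2001 ([:1, 1:] ^ 2)) (length I + k) = 2001 * (length I + k + 1)\<^sup>2"
      by (simp add: poly_power)
    moreover have "2001 * (length I + 1)\<^sup>2 \<le> 2001 * (length I + k + 1)\<^sup>2"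
      by (intro mult_le_mono2 power_mono) auto
    ultimately have poly: "t \<le> poly (Polynomial.smult 2001 ([:1, 1:] ^ 2)) (length I + k)"
      if "t \<le> 2001 * (length I + 1)\<^sup>2" for t
      using that by linarith
    obtain t where t: "t \<le> 2001 * (length I + 1)\<^sup>2" "reduces (A \<alpha>) I k t (reduced (c \<alpha>) I k) k"
      using reduces_exists unfolding A_def by blast
    show "\<exists>t I' k'. reduces (A \<alpha>) I k t I' k' \<and>
      t \<le> poly (Polynomial.smult 2001 ([:1, 1:] ^ 2)) (length I + k) \<and>
      (\<forall>s'\<in>solutions I' k'. \<exists>t' s. lifts (A \<alpha>) I k I' k' s' t' s \<and>
        t' \<le> poly (Polynomial.smult 2001 ([:1, 1:] ^ 2)) (length I + k) \<and>
        s \<in> solutions I k \<and> ratio PVC I' k' s' \<le> ereal \<alpha> * ratio PVC I k s)"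
      (is "\<exists>t I' k'. _ \<and> _ \<and> ?lift I' k'")
    proof -
      have "?lift (reduced (c \<alpha>) I k) k"
      proof
        fix s'
        assume s': "s' \<in> solutions (reduced (c \<alpha>) I k) k"
        obtain t' where "t' \<le> 2001 * (length I + 1)\<^sup>2"
            "lifts (A \<alpha>) I k (reduced (c \<alpha>) I k) k s' t' (lifted (c \<alpha>) I k s')"
          using lifts_exists unfolding A_def by blast
        with poly approx_of_strict[OF that s' lifted_in_solutions ratio_lifted[OF that c s']]
          lifted_in_solutions
        show "\<exists>t' s. lifts (A \<alpha>) I k (reduced (c \<alpha>) I k) k s' t' s \<and>
            t' \<le> poly (Polynomial.smult 2001 ([:1, 1:] ^ 2)) (length I + k) \<and>
            s \<in> solutions I k \<and> ratio PVC (reduced (c \<alpha>) I k) k s' \<le> ereal \<alpha> * ratio PVC I k s"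
          by blast
      qed
      with t poly show ?thesis
        by blast
    qed
  qed
  have size: "length I' + k' \<le> ((c \<alpha> + 1) ^ 4 + 1) * k ^ 10" if "reduces (A \<alpha>) I k t I' k'"
    for \<alpha> I k t I' k'
    using length_reduced_bound reducesD[OF that[unfolded A_def]] by simp
  have "poly_size (A \<alpha>)" for \<alpha>
    unfolding poly_size_def
    by (rule exI[of _ "Polynomial.monom ((c \<alpha> + 1) ^ 4 + 1) 10"])
      (metis poly_monom size)
  with strict approx have "strict_PSAKS PVC A"
    by (simp add: strict_PSAKS_def PSAKS_def approx_poly_kernel_def)
  moreover have "size_efficient A"
    unfolding size_efficient_def
  proof (intro exI allI impI)
    fix \<alpha> I k t I' k'
    assume "reduces (A \<alpha>) I k t I' k'"
    from of_nat_mono[OF size[OF this], where 'a = real]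
    show "real (length I' + k') \<le> real ((c \<alpha> + 1) ^ 4 + 1) * real k ^ 10"
      by (simp only: of_nat_mult of_nat_power)
  qed
  moreover have "time_efficient A"
  proof -
    have time: "real t \<le> 8004 * real (max 1 (length I)) ^ 2" if "t \<le> 2001 * (length I + 1)\<^sup>2"
      for t and I :: "bool list"
    proof -
      \<comment> \<open>The factor 8004 is four times 2001, because \<open>length I + 1\<close> is
        at most twice the length counted as at least 1.\<close>
      have "(length I + 1)\<^sup>2 \<le> (2 * max 1 (length I))\<^sup>2"
        by (intro power_mono) auto
      then have "t \<le> 8004 * max 1 (length I) ^ 2"
        using that by (simp add: power_mult_distrib)
      from of_nat_mono[OF this, where 'a = real] show ?thesis
        by simp
    qed
    show ?thesis
      unfolding time_efficient_def A_def
      \<comment> \<open>The factor is constant in \<alpha>, because the time bounds hold for every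
        \<open>c\<close> alike.\<close>
      by (rule exI[of _ "\<lambda>_. 8004"], rule exI[of _ 2])
        (use time reducesD(3) liftsD(2) in blast)
  qed
  ultimately show ?thesis
    by blast
qed

end
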